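(* Let $u$ be the Lévy density of an infinite activity pure jump subordinator. Let $n\in\mathbb{N}$, and suppose that for some integer $m\ge n+2$ and some real $r>0$ the function $u$ is $m$-times continuously differentiable on $(0,\infty)$ and $$\int_0^\infty e^{-rx}x^{k+1}|u^{(k)}(x)|\,dx<\infty,\qquad k=0,1,\ldots,m.$$ (i) Let $U^+(x)=\int_x^\infty u(y)\,dy$ for $x>0$. Then the $n$th convolution power $(U^+)^{*n}(x)$ is well defined for $x>0$ and $(U^+)^{*n}$ is $n$-times continuously differentiable on $(0,\infty)$. (ii) For $\varepsilon>0$ and $x>0$ set $u_\varepsilon(x)=e^{-\varepsilon/x}u(x)$, $c(\varepsilon)=\int_0^\infty u_\varepsilon(x)\,dx$ and $$u_{n\varepsilon}(x)=\sum_{k=1}^n(-1)^{n-k}\binom{n}{k}u_\varepsilon^{*k}(x)\,c(\varepsilon)^{n-k}.$$ Then $\lim_{\varepsilon\to0}u_{n\varepsilon}(x)=u_n(x)$ for every $x>0$, where $$u_n(x)=(-1)^n\frac{d^n}{dx^n}(U^+)^{*n}(x).$$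
   Context: The Lévy density of an infinite activity pure jump subordinator (no linear drift) is a function $u:(0,\infty)\to[0,\infty)$ with $\int_0^\infty(1\wedge x)u(x)\,dx<\infty$ and $\int_0^\infty u(x)\,dx=\infty$. For functions $f,g$ on $(0,\infty)$ the convolution is $(f*g)(x)=\int_0^x f(y)g(x-y)\,dy$, and $f^{*k}$ denotes the $k$-fold convolution power, $f^{*1}=f$. The limit $\varepsilon\to0$ is through $\varepsilon>0$. *)

theory Defs
  imports "HOL-Analysis.Analysis"
begin

text \<open>
  Functions on \<open>(0,\<infinity>)\<close> are represented by total functions \<open>real \<Rightarrow> real\<close>; no definition below looks at
  their values on \<open>(-\<infinity>,0]\<close> when evaluated at positive arguments.
\<close>

definition levy_density :: "(real \<Rightarrow> real) \<Rightarrow> bool" where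
  "levy_density u \<longleftrightarrow>
     set_borel_measurable lborel {0<..} u \<and>
     (\<forall>x>0. 0 \<le> u x) \<and>
     (\<integral>\<^sup>+x\<in>{0<..}. ennreal (min 1 x * u x) \<partial>lborel) < \<infinity> \<and>
     (\<integral>\<^sup>+x\<in>{0<..}. ennreal (u x) \<partial>lborel) = \<infinity>"

text \<open>
  Since \<open>(0,\<infinity>)\<close> is open, the iterated \<^const>\<open>deriv\<close> at a positive point depends only on the
  function near that point.
\<close>

definition cont_diff_pos :: "nat \<Rightarrow> (real \<Rightarrow> real) \<Rightarrow> bool" where
  "cont_diff_pos m f \<longleftrightarrow>
     (\<forall>k<m. \<forall>x>0. (deriv ^^ k) f differentiable at x) \<and>
     continuous_on {0<..} ((deriv ^^ m) f)"

definition conv :: "(real \<Rightarrow> real) \<Rightarrow> (real \<Rightarrow> real) \<Rightarrow> real \<Rightarrow> real" where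
  "conv f g x = (LBINT y:{0<..<x}. f y * g (x - y))"

text \<open>The \<open>k\<close>-fold convolution power for \<open>k \<ge> 1\<close>; it is left unspecified for \<open>k = 0\<close>.\<close>

fun conv_pow :: "(real \<Rightarrow> real) \<Rightarrow> nat \<Rightarrow> real \<Rightarrow> real" where
  "conv_pow f (Suc 0) = f"
| "conv_pow f (Suc (Suc k)) = conv (conv_pow f (Suc k)) f"

text \<open>
  Because the Bochner integral of a non-integrable function is \<open>0\<close> by convention, the existence of
  all integrals entering \<open>conv_pow f k x\<close> is a separate predicate.
\<close>

fun conv_pow_defined :: "(real \<Rightarrow> real) \<Rightarrow> nat \<Rightarrow> real \<Rightarrow> bool" where
  "conv_pow_defined f (Suc 0) x \<longleftrightarrow> True"
| "conv_pow_defined f (Suc (Suc k)) x \<longleftrightarrow>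
     (\<forall>y\<in>{0<..<x}. conv_pow_defined f (Suc k) y) \<and>
     set_integrable lborel {0<..<x} (\<lambda>y. conv_pow f (Suc k) y * f (x - y))"

definition tail :: "(real \<Rightarrow> real) \<Rightarrow> real \<Rightarrow> real" where
  "tail u x = (LBINT y:{x<..}. u y)"

definition damped :: "(real \<Rightarrow> real) \<Rightarrow> real \<Rightarrow> real \<Rightarrow> real" where
  "damped u \<epsilon> x = exp (- \<epsilon> / x) * u x"

definition damped_mass :: "(real \<Rightarrow> real) \<Rightarrow> real \<Rightarrow> real" where
  "damped_mass u \<epsilon> = (LBINT x:{0<..}. damped u \<epsilon> x)"

definition u_approx :: "(real \<Rightarrow> real) \<Rightarrow> nat \<Rightarrow> real \<Rightarrow> real \<Rightarrow> real" where
  "u_approx u n \<epsilon> x =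
     (\<Sum>k=1..n. (-1) ^ (n - k) * real (n choose k) * conv_pow (damped u \<epsilon>) k x
                  * damped_mass u \<epsilon> ^ (n - k))"

definition u_limit :: "(real \<Rightarrow> real) \<Rightarrow> nat \<Rightarrow> real \<Rightarrow> real" where
  "u_limit u n x = (-1) ^ n * (deriv ^^ n) (conv_pow (tail u) n) x"

end

theory Submission
  imports Defs
begin

text \<open>
  The Euler operator \<open>\<theta> f = (x f)'\<close> is a derivation of the convolution product, because multiplication by
  \<open>x\<close> is one. Hence it suffices that all \<open>\<theta>\<^sup>k U\<^sup>+\<close> are integrable near \<open>0\<close>, which is what the weights
  \<open>x\<^sup>k\<^sup>+\<^sup>1\<close> in the hypotheses provide; the non-integrability of \<open>1/x\<close> rules out boundary terms at \<open>0\<close>. As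
  \<open>f' = (\<theta> f - f) / x\<close>, convolution powers of \<open>U\<^sup>+\<close> inherit the differentiability of \<open>U\<^sup>+\<close>.

  For the tail \<open>F\<close> of \<open>u\<^sub>\<epsilon>\<close> one has \<open>(h * F)' = c(\<epsilon>) h - h * u\<^sub>\<epsilon>\<close>, and \<open>F\<close> itself is this expression for
  \<open>h = 1\<close>. Iterating, \<open>(-1)\<^sup>n\<close> times the \<open>n\<close>th derivative of the \<open>n\<close>th convolution power of \<open>F\<close> is exactly
  \<open>u\<^sub>n\<^sub>\<epsilon>\<close>. Finally \<open>\<theta>\<^sup>k F\<close> is dominated uniformly in \<open>\<epsilon>\<close> and converges pointwise, a property which is stable
  under convolution, so that the derivatives converge.
\<close>

subsection \<open>Convolution of locally integrable functions\<close>

text \<open>Only the behaviour near \<open>0\<close> needs control: continuity bounds the function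
  on compact parts of the open half-line, and a convolution at \<open>x\<close> never looks beyond
  \<open>x\<close>, so growth at infinity is free.\<close>

definition loc_int :: "(real \<Rightarrow> real) \<Rightarrow> bool" where
  "loc_int f \<longleftrightarrow> continuous_on {0<..} f \<and> (\<forall>x>0. set_integrable lborel {0<..<x} f)"

text \<open>Extension by zero turns a convolution into an integral over the whole line, where
  translation, reflection and Fubini apply without moving limits.\<close>

definition on_pos :: "(real \<Rightarrow> real) \<Rightarrow> real \<Rightarrow> real" where
  "on_pos f x = (if 0 < x then f x else 0)"

lemma on_pos_eq: "0 < x \<Longrightarrow> on_pos f x = f x"
  by (simp add: on_pos_def)

lemma borel_measurable_on_pos:
  assumes "continuous_on {0<..} f"
  shows "on_pos f \<in> borel_measurable borel"
proof -
  have "on_pos f = (\<lambda>x. indicator {0<..} x *\<^sub>R f x)"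
    by (auto simp: on_pos_def fun_eq_iff)
  then show ?thesis
    using borel_measurable_continuous_on_indicator[OF _ assms] by simp
qed

lemma loc_int_measurable [measurable_dest]: "loc_int f \<Longrightarrow> on_pos f \<in> borel_measurable borel"
  by (simp add: loc_int_def borel_measurable_on_pos)

lemma loc_int_trunc:
  assumes "loc_int f"
  shows "integrable lborel (\<lambda>y. indicator {0<..<x} y * on_pos f y)"
proof (cases "0 < x")
  case True
  then have "integrable lborel (\<lambda>y. indicator {0<..<x} y * f y)"
    using assms by (auto simp: loc_int_def set_integrable_def)
  also have "(\<lambda>y. indicator {0<..<x} y * f y) = (\<lambda>y. indicator {0<..<x} y * on_pos f y)"
    by (auto simp: on_pos_def fun_eq_iff split: split_indicator)
  finally show ?thesis .
qed simp

lemma loc_intI: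
  assumes "continuous_on {0<..} f"
    and "\<And>x. 0 < x \<Longrightarrow> integrable lborel (\<lambda>y. indicator {0<..<x} y * on_pos f y)"
  shows "loc_int f"
  unfolding loc_int_def set_integrable_def
proof (intro conjI allI impI)
  fix x :: real assume "0 < x"
  then have "integrable lborel (\<lambda>y. indicator {0<..<x} y * on_pos f y)" by (rule assms)
  also have "(\<lambda>y. indicator {0<..<x} y * on_pos f y) = (\<lambda>y. indicator {0<..<x} y *\<^sub>R f y)"
    by (auto simp: on_pos_def fun_eq_iff split: split_indicator)
  finally show "integrable lborel (\<lambda>y. indicator {0<..<x} y *\<^sub>R f y)" .
qed (rule assms)

lemma loc_int_bound:
  assumes "loc_int f" "loc_int g" "0 < a"
  obtains M where "\<And>y. a \<le> y \<Longrightarrow> y \<le> b \<Longrightarrow> \<bar>f y\<bar> \<le> M" "\<And>y. a \<le> y \<Longrightarrow> y \<le> b \<Longrightarrow> \<bar>g y\<bar> \<le> M" "0 \<le> M"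
proof -
  have *: "\<exists>M. \<forall>y\<in>{a..b}. \<bar>h y\<bar> \<le> M" if "loc_int h" for h
  proof -
    have "continuous_on {a..b} h"
      using that assms(3) by (auto simp: loc_int_def intro: continuous_on_subset)
    then have "bounded (h ` {a..b})"
      by (intro compact_imp_bounded compact_continuous_image) auto
    then show ?thesis by (auto simp: bounded_iff)
  qed
  from *[OF assms(1)] *[OF assms(2)] obtain M N where
    "\<forall>y\<in>{a..b}. \<bar>f y\<bar> \<le> M" "\<forall>y\<in>{a..b}. \<bar>g y\<bar> \<le> N" by blast
  then show ?thesis
    by (intro that[of "\<bar>M\<bar> + \<bar>N\<bar>"]) force+
qed

lemma loc_int_add: "loc_int f \<Longrightarrow> loc_int g \<Longrightarrow> loc_int (\<lambda>x. f x + g x)"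
  by (auto simp: loc_int_def intro!: continuous_intros set_integral_add)

lemma loc_int_cmult: "loc_int f \<Longrightarrow> loc_int (\<lambda>x. c * f x)"
  by (auto simp: loc_int_def intro!: continuous_intros)

lemma loc_int_diff: "loc_int f \<Longrightarrow> loc_int g \<Longrightarrow> loc_int (\<lambda>x. f x - g x)"
  by (auto simp: loc_int_def intro!: continuous_intros set_integral_diff)

lemma loc_int_abs: "loc_int f \<Longrightarrow> loc_int (\<lambda>x. \<bar>f x\<bar>)"
  by (auto simp: loc_int_def intro!: continuous_intros set_integrable_abs)

lemma loc_int_const: "loc_int (\<lambda>_. c)"
  unfolding loc_int_def
proof (intro conjI allI impI continuous_on_const)
  fix x :: real
  show "set_integrable lborel {0<..<x} (\<lambda>_. c)"
    by (rule set_integrable_subset[OF borel_integrable_atLeastAtMost'[of 0 x]]) auto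
qed

lemma loc_int_cong:
  assumes "loc_int f" "\<And>x. 0 < x \<Longrightarrow> g x = f x"
  shows "loc_int g"
proof -
  have "continuous_on {0<..} g = continuous_on {0<..} f"
    by (rule continuous_on_cong) (use assms(2) in auto)
  moreover have "set_integrable lborel {0<..<x} g = set_integrable lborel {0<..<x} f" for x
    by (rule set_integrable_cong) (use assms(2) in auto)
  ultimately show ?thesis using assms(1) by (simp add: loc_int_def)
qed

lemma loc_int_dominated:
  assumes "continuous_on {0<..} f" "loc_int B" "\<And>x. 0 < x \<Longrightarrow> \<bar>f x\<bar> \<le> B x"
  shows "loc_int f"
proof (rule loc_intI)
  fix x :: real assume "0 < x"
  have [measurable]: "on_pos f \<in> borel_measurable borel"
    by (rule borel_measurable_on_pos) fact
  show "integrable lborel (\<lambda>y. indicator {0<..<x} y * on_pos f y)"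
    by (rule Bochner_Integration.integrable_bound[OF loc_int_trunc[OF assms(2), of x]])
      (auto simp: on_pos_eq split: split_indicator intro!: AE_I2 order_trans[OF assms(3)])
qed fact

section \<open>Convolution as an integral over the whole line\<close>

lemma conv_on_pos: "conv f g x = (\<integral>y. on_pos f y * on_pos g (x - y) \<partial>lborel)"
  unfolding conv_def set_lebesgue_integral_def
  by (intro Bochner_Integration.integral_cong) (auto simp: on_pos_def split: split_indicator)

lemma conv_nonpos: "x \<le> 0 \<Longrightarrow> conv f g x = 0"
  by (simp add: conv_def set_lebesgue_integral_def)

lemma on_pos_conv: "on_pos (conv f g) = conv f g"
  by (auto simp: on_pos_def conv_nonpos)

lemma conv_cong:
  assumes "\<And>x. 0 < x \<Longrightarrow> f x = f' x" "\<And>x. 0 < x \<Longrightarrow> g x = g' x"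
  shows "conv f g = conv f' g'"
  unfolding conv_on_pos[abs_def] on_pos_def using assms
  by (intro ext Bochner_Integration.integral_cong) auto

text \<open>At most one of \<open>y\<close> and \<open>x - y\<close> is below \<open>x/2\<close>, so
  at each point one factor is bounded while the other is integrable.\<close>

lemma conv_integrable:
  assumes "loc_int f" "loc_int g"
  shows "integrable lborel (\<lambda>y. on_pos f y * on_pos g (x - y))"
proof (cases "0 < x")
  case True
  obtain M where M: "\<And>y. x/2 \<le> y \<Longrightarrow> y \<le> x \<Longrightarrow> \<bar>f y\<bar> \<le> M"
    "\<And>y. x/2 \<le> y \<Longrightarrow> y \<le> x \<Longrightarrow> \<bar>g y\<bar> \<le> M" "0 \<le> M"
    using loc_int_bound[OF assms, of "x/2" x] True by auto
  note [measurable] = loc_int_measurable[OF assms(1)] loc_int_measurable[OF assms(2)]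
  let ?F = "\<lambda>y. \<bar>indicator {0<..<x} y * on_pos f y\<bar>" and ?G = "\<lambda>y. \<bar>indicator {0<..<x} y * on_pos g y\<bar>"
  have 1: "integrable lborel ?F" and 2: "integrable lborel ?G"
    by (intro integrable_abs loc_int_trunc assms)+
  have 3: "integrable lborel (\<lambda>y. ?G (x + (-1) * y))"
    by (rule lborel_integrable_real_affine[OF 2]) simp
  \<comment> \<open>The majorant covers both halves at once: \<open>?F\<close> serves where
    \<open>g\<close> is bounded by \<open>M\<close>, the reflected \<open>?G\<close> where
    \<open>f\<close> is.\<close>
  have "integrable lborel (\<lambda>y. M * (?F y + ?G (x + (-1) * y)))"
    using 1 3 by (intro integrable_mult_right Bochner_Integration.integrable_add)
  then show ?thesis
  proof (rule Bochner_Integration.integrable_bound)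
    show "(\<lambda>y. on_pos f y * on_pos g (x - y)) \<in> borel_measurable lborel"
      by measurable
    show "AE y in lborel. norm (on_pos f y * on_pos g (x - y)) \<le> norm (M * (?F y + ?G (x + (-1) * y)))"
    proof (rule AE_I2)
      fix y
      consider "y \<le> 0 \<or> x \<le> y" | "0 < y" "y \<le> x/2" | "x/2 < y" "y < x" by linarith
      then show "norm (on_pos f y * on_pos g (x - y)) \<le> norm (M * (?F y + ?G (x + (-1) * y)))"
      proof cases
        case 1 then show ?thesis using M(3) by (auto simp: on_pos_def)
      next
        case 2
        then have "\<bar>f y\<bar> * \<bar>g (x - y)\<bar> \<le> \<bar>f y\<bar> * M" by (intro mult_left_mono M) auto
        also have "\<dots> \<le> M * (\<bar>f y\<bar> + \<bar>g (x-y)\<bar>)" using M(3) by (simp add: algebra_simps)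
        finally show ?thesis using 2 True M(3) by (simp add: on_pos_def abs_mult)
      next
        case 3
        then have "\<bar>f y\<bar> * \<bar>g (x - y)\<bar> \<le> M * \<bar>g (x-y)\<bar>" by (intro mult_right_mono M) auto
        also have "\<dots> \<le> M * (\<bar>f y\<bar> + \<bar>g (x-y)\<bar>)" using M(3) by (simp add: algebra_simps)
        finally show ?thesis using 3 True M(3) by (simp add: on_pos_def abs_mult)
      qed
    qed
  qed
next
  case False
  then have "(\<lambda>y. on_pos f y * on_pos g (x - y)) = (\<lambda>_. 0)" by (auto simp: on_pos_def fun_eq_iff)
  then show ?thesis by simp
qed

lemma conv_set_integrable:
  assumes "loc_int f" "loc_int g"
  shows "set_integrable lborel {0<..<x} (\<lambda>y. f y * g (x - y))"
proof -
  have "(\<lambda>y. on_pos f y * on_pos g (x - y)) = (\<lambda>y. indicator {0<..<x} y *\<^sub>R (f y * g (x - y)))"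
    by (auto simp: on_pos_def fun_eq_iff split: split_indicator)
  then show ?thesis using conv_integrable[OF assms, of x] by (simp add: set_integrable_def)
qed

lemma conv_commute: "conv f g = conv g f"
proof
  fix x
  have "conv f g x = (\<integral>y. on_pos f (x + (-1) * y) * on_pos g (x - (x + (-1) * y)) \<partial>lborel)"
    unfolding conv_on_pos by (subst lborel_integral_real_affine[of "-1" _ x]) auto
  then show "conv f g x = conv g f x" by (simp add: conv_on_pos mult.commute)
qed

lemma conv_add_left:
  assumes "loc_int f" "loc_int g" "loc_int h"
  shows "conv (\<lambda>x. f x + g x) h = (\<lambda>x. conv f h x + conv g h x)"
proof
  fix x
  show "conv (\<lambda>x. f x + g x) h x = conv f h x + conv g h x"
    using set_integral_add(2)[OF conv_set_integrable[OF assms(1,3), of x] conv_set_integrable[OF assms(2,3), of x]]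
    by (simp add: conv_def distrib_right)
qed

lemma conv_cmult_left: "conv (\<lambda>x. c * f x) h = (\<lambda>x. c * conv f h x)"
  by (simp add: conv_def[abs_def] mult.assoc)

lemma conv_diff_left:
  assumes "loc_int f" "loc_int g" "loc_int h"
  shows "conv (\<lambda>x. f x - g x) h = (\<lambda>x. conv f h x - conv g h x)"
  using conv_add_left[OF assms(1) loc_int_cmult[OF assms(2), of "-1"] assms(3)]
    conv_cmult_left[of "-1" g h] by simp

lemma conv_sum_left:
  assumes "finite I" "\<And>i. i \<in> I \<Longrightarrow> loc_int (f i)" "loc_int h"
  shows "conv (\<lambda>x. \<Sum>i\<in>I. f i x) h = (\<lambda>x. \<Sum>i\<in>I. conv (f i) h x) \<and> loc_int (\<lambda>x. \<Sum>i\<in>I. f i x)"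
  using assms(1,2)
proof (induction I)
  case empty
  then show ?case using loc_int_const[of 0] by (simp add: conv_def[abs_def] set_lebesgue_integral_def)
next
  case (insert i I)
  then show ?case
    using conv_add_left[of "f i" "\<lambda>x. \<Sum>i\<in>I. f i x" h] assms(3)
    by (auto intro!: loc_int_add)
qed

text \<open>For \<open>y < x/2\<close> the second factor is evaluated beyond \<open>x/2\<close>,
  away from its possible singularity, so dominated convergence applies with a multiple of the first
  factor.\<close>

lemma isCont_conv_left_half:
  assumes f: "loc_int f" and g: "loc_int g" and x: "0 < x"
  shows "isCont (\<lambda>x. \<integral>y. indicator {0<..<x/2} y * (on_pos f y * on_pos g (x - y)) \<partial>lborel) x"
  unfolding continuous_at_sequentially comp_def
proof (intro allI impI)
  fix X assume X: "X \<longlonglongrightarrow> x"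
  \<comment> \<open>For these indices \<open>y < X n / 2\<close> forces
    \<open>x/3 < X n - y < 2 * x\<close> and \<open>y < x\<close>, which explains the interval for
    \<open>M\<close> and the cutoff of the majorant.\<close>
  have ev: "eventually (\<lambda>n. 2*x/3 < X n \<and> X n < 2 * x) sequentially"
    using order_tendstoD[OF X, of "2*x/3"] order_tendstoD(2)[OF X, of "2*x"] x
    by (auto simp: eventually_conj_iff)
  obtain N where N: "\<And>n. n \<ge> N \<Longrightarrow> 2*x/3 < X n \<and> X n < 2 * x"
    using ev by (auto simp: eventually_sequentially)
  obtain M where M: "\<And>y. x/3 \<le> y \<Longrightarrow> y \<le> 2*x \<Longrightarrow> \<bar>g y\<bar> \<le> M" "0 \<le> M"
    using loc_int_bound[OF f g, of "x/3" "2*x"] x by (metis zero_less_divide_iff zero_less_numeral)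
  note [measurable] = loc_int_measurable[OF f] loc_int_measurable[OF g]
  have "(\<lambda>n. \<integral>y. indicator {0<..<X (n+N)/2} y * (on_pos f y * on_pos g (X (n+N) - y)) \<partial>lborel)
    \<longlonglongrightarrow> (\<integral>y. indicator {0<..<x/2} y * (on_pos f y * on_pos g (x - y)) \<partial>lborel)"
  proof (rule integral_dominated_convergence)
    show "integrable lborel (\<lambda>y. M * \<bar>indicator {0<..<x} y * on_pos f y\<bar>)"
      by (intro integrable_mult_right integrable_abs loc_int_trunc f)
    show "AE y in lborel. norm (indicator {0<..<X (n+N)/2} y * (on_pos f y * on_pos g (X (n+N) - y)))
       \<le> M * \<bar>indicator {0<..<x} y * on_pos f y\<bar>" for n
    proof (rule AE_I2)
      fix y
      show "norm (indicator {0<..<X (n+N)/2} y * (on_pos f y * on_pos g (X (n+N) - y)))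
       \<le> M * \<bar>indicator {0<..<x} y * on_pos f y\<bar>"
      proof (cases "0 < y \<and> y < X (n+N) / 2")
        case True
        then have "\<bar>g (X (n+N) - y)\<bar> \<le> M" using N[of "n+N"] by (intro M) auto
        then have "\<bar>f y\<bar> * \<bar>g (X (n+N) - y)\<bar> \<le> M * \<bar>f y\<bar>"
          by (subst mult.commute) (intro mult_right_mono, auto)
        then show ?thesis using True N[of "n+N"] by (simp add: on_pos_def abs_mult)
      qed (use M(2) in auto)
    qed
    \<comment> \<open>At \<open>y = x/2\<close> the moving indicator need not converge.\<close>
    have "AE y in lborel. y \<noteq> x/2" by (rule AE_lborel_singleton)
    then show "AE y in lborel. (\<lambda>n. indicator {0<..<X (n+N)/2} y * (on_pos f y * on_pos g (X (n+N) - y)))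
      \<longlonglongrightarrow> indicator {0<..<x/2} y * (on_pos f y * on_pos g (x - y))"
    proof eventually_elim
      case (elim y)
      have XN: "(\<lambda>n. X (n+N)) \<longlonglongrightarrow> x" using X by (rule LIMSEQ_ignore_initial_segment)
      consider "y \<le> 0" | "0 < y" "y < x/2" | "x/2 < y" using elim by linarith
      then show ?case
      proof cases
        case 1 then show ?thesis by simp
      next
        case 2
        have "continuous_on {0<..} g" using g by (simp add: loc_int_def)
        then have c: "isCont g (x - y)" using 2 x by (simp add: continuous_on_eq_continuous_at)
        have t: "(\<lambda>n. X (n+N) - y) \<longlonglongrightarrow> x - y" by (intro tendsto_intros XN)
        have "(\<lambda>n. f y * g (X (n+N) - y)) \<longlonglongrightarrow> f y * g (x - y)"
          by (intro tendsto_intros isCont_tendsto_compose[OF c] t)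
        moreover have "eventually (\<lambda>n. 2 * y < X (n+N)) sequentially"
          using order_tendstoD(1)[OF XN, of "2*y"] 2 by auto
        then have "eventually (\<lambda>n. f y * g (X (n+N) - y) = indicator {0<..<X (n+N)/2} y * (on_pos f y * on_pos g (X (n+N) - y))) sequentially"
          by eventually_elim (use 2 in \<open>auto simp: on_pos_def\<close>)
        ultimately show ?thesis using 2 x by (simp add: tendsto_cong on_pos_def)
      next
        case 3
        then have "eventually (\<lambda>n. X (n+N) < 2 * y) sequentially"
          using order_tendstoD(2)[OF XN, of "2*y"] by auto
        then have "eventually (\<lambda>n. indicator {0<..<X (n+N)/2} y * (on_pos f y * on_pos g (X (n+N) - y)) = 0) sequentially"
          by eventually_elim auto
        then show ?thesis using 3 by (simp add: tendsto_eventually)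
      qed
    qed
  qed (measurable)
  then show "(\<lambda>n. \<integral>y. indicator {0<..<X n/2} y * (on_pos f y * on_pos g (X n - y)) \<partial>lborel)
    \<longlonglongrightarrow> (\<integral>y. indicator {0<..<x/2} y * (on_pos f y * on_pos g (x - y)) \<partial>lborel)"
    by (rule LIMSEQ_offset)
qed

text \<open>Reflection carries the right half of the integral to a left half with the factors
  exchanged, so continuity has to be proved for left halves only.\<close>

lemma conv_split:
  assumes f: "loc_int f" and g: "loc_int g"
  shows "conv f g x = (\<integral>y. indicator {0<..<x/2} y * (on_pos f y * on_pos g (x - y)) \<partial>lborel)
    + (\<integral>y. indicator {0<..<x/2} y * (on_pos g y * on_pos f (x - y)) \<partial>lborel)" (is "_ = ?A + ?B")
proof -
  note [measurable] = loc_int_measurable[OF f] loc_int_measurable[OF g]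
  have i: "integrable lborel (\<lambda>y. indicator A y * (on_pos f y * on_pos g (x - y)))"
    if "A \<in> sets borel" for A
    using integrable_mult_indicator[OF _ conv_integrable[OF f g, of x]] that by simp
  have "?B = (\<integral>y. indicator {x/2<..<x} y * (on_pos f y * on_pos g (x - y)) \<partial>lborel)"
    by (subst lborel_integral_real_affine[of "-1" _ x])
      (auto intro!: Bochner_Integration.integral_cong split: split_indicator)
  then have "?A + ?B = (\<integral>y. indicator {0<..<x/2} y * (on_pos f y * on_pos g (x - y)) +
     indicator {x/2<..<x} y * (on_pos f y * on_pos g (x - y)) \<partial>lborel)"
    using i by (subst Bochner_Integration.integral_add) auto
  also have "\<dots> = conv f g x"
    unfolding conv_on_pos
  proof (rule integral_cong_AE)
    show "AE y in lborel. indicator {0<..<x/2} y * (on_pos f y * on_pos g (x - y)) +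
     indicator {x/2<..<x} y * (on_pos f y * on_pos g (x - y)) = on_pos f y * on_pos g (x - y)"
      using AE_lborel_singleton[of "x/2"]
      by eventually_elim (auto simp: on_pos_def split: split_indicator)
  qed measurable
  finally show ?thesis by simp
qed

lemma continuous_on_conv:
  assumes f: "loc_int f" and g: "loc_int g"
  shows "continuous_on {0<..} (conv f g)"
proof (rule continuous_at_imp_continuous_on, intro ballI)
  fix x :: real assume "x \<in> {0<..}"
  then show "isCont (conv f g) x"
    unfolding conv_split[OF f g, abs_def]
    by (intro continuous_add isCont_conv_left_half f g) auto
qed

text \<open>On \<open>(0,x)\<close> the convolution depends only on the factors cut off to
  \<open>(0,x)\<close>; these are integrable on the line, and Fubini makes their convolution
  integrable.\<close>

lemma loc_int_conv:
  assumes f: "loc_int f" and g: "loc_int g"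
  shows "loc_int (conv f g)"
proof (rule loc_intI)
  show "continuous_on {0<..} (conv f g)" by (rule continuous_on_conv) fact+
  fix x :: real assume x: "0 < x"
  define f1 where "f1 = (\<lambda>y. indicator {0<..<x} y * on_pos f y)"
  define g1 where "g1 = (\<lambda>y. indicator {0<..<x} y * on_pos g y)"
  have if1: "integrable lborel f1" and ig1: "integrable lborel g1"
    unfolding f1_def g1_def by (intro loc_int_trunc f g)+
  have [measurable]: "f1 \<in> borel_measurable borel" "g1 \<in> borel_measurable borel"
    using if1 ig1 by (auto dest!: borel_measurable_integrable)
  have tr: "(\<integral>z. h (z - y) \<partial>lborel) = (\<integral>z. h z \<partial>lborel)" for h :: "real \<Rightarrow> real" and y
    by (subst (2) lborel_integral_real_affine[of 1 _ "-y"]) auto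
  have "integrable (lborel \<Otimes>\<^sub>M lborel) (\<lambda>(y,z). f1 y * g1 (z - y))"
  proof (rule lborel_pair.Fubini_integrable)
    show "(\<lambda>(y,z). f1 y * g1 (z - y)) \<in> borel_measurable (lborel \<Otimes>\<^sub>M lborel)" by measurable
    have "(\<lambda>y. \<integral>z. norm (case (y, z) of (y, z) \<Rightarrow> f1 y * g1 (z - y)) \<partial>lborel) = (\<lambda>y. \<bar>f1 y\<bar> * (\<integral>z. \<bar>g1 z\<bar> \<partial>lborel))"
      using tr[of "\<lambda>z. \<bar>g1 z\<bar>"] by (simp add: abs_mult)
    then show "integrable lborel (\<lambda>y. \<integral>z. norm (case (y, z) of (y, z) \<Rightarrow> f1 y * g1 (z - y)) \<partial>lborel)"
      using if1 by auto
    show "AE y in lborel. integrable lborel (\<lambda>z. case (y, z) of (y, z) \<Rightarrow> f1 y * g1 (z - y))"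
      using lborel_integrable_real_affine[OF ig1, of 1 "- y" for y] by (auto intro!: AE_I2)
  qed
  then have "integrable lborel (\<lambda>z. \<integral>y. f1 y * g1 (z - y) \<partial>lborel)"
    using lborel_pair.integrable_fst[of "\<lambda>z y. f1 y * g1 (z - y)"] lborel_pair.integrable_product_swap_iff[of "\<lambda>(y,z). f1 y * g1 (z - y)"]
    by (simp add: case_prod_unfold)
  then have "integrable lborel (\<lambda>z. indicator {0<..<x} z * (\<integral>y. f1 y * g1 (z - y) \<partial>lborel))"
    using integrable_mult_indicator[of "{0<..<x}" lborel "\<lambda>z. \<integral>y. f1 y * g1 (z - y) \<partial>lborel"] by simp
  also have "(\<lambda>z. indicator {0<..<x} z * (\<integral>y. f1 y * g1 (z - y) \<partial>lborel)) =
     (\<lambda>z. indicator {0<..<x} z * on_pos (conv f g) z)"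
    unfolding on_pos_conv conv_on_pos f1_def g1_def
    by (auto simp: fun_eq_iff on_pos_def split: split_indicator intro!: Bochner_Integration.integral_cong)
  finally show "integrable lborel (\<lambda>y. indicator {0<..<x} y * on_pos (conv f g) y)" .
qed

text \<open>Fubini for the kernel \<open>?K\<close>: integrating its absolute value in
  \<open>y\<close> leaves the integrand of a convolution of nonnegative functions, whose
  integrability is \<open>conv_integrable\<close>.\<close>

lemma conv_assoc:
  assumes f: "loc_int f" and g: "loc_int g" and h: "loc_int h"
  shows "conv (conv f g) h = conv f (conv g h)"
proof
  fix x
  note [measurable] = loc_int_measurable[OF f] loc_int_measurable[OF g] loc_int_measurable[OF h]
  let ?K = "\<lambda>z y. on_pos f y * on_pos g (z - y) * on_pos h (x - z)"
  have oa: "\<bar>on_pos k t\<bar> = on_pos (\<lambda>x. \<bar>k x\<bar>) t" for k t by (simp add: on_pos_def)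
  have I: "integrable (lborel \<Otimes>\<^sub>M lborel) (\<lambda>(z,y). ?K z y)"
  proof (rule lborel_pair.Fubini_integrable)
    show "(\<lambda>(z,y). ?K z y) \<in> borel_measurable (lborel \<Otimes>\<^sub>M lborel)" by measurable
    show "AE z in lborel. integrable lborel (\<lambda>y. case (z,y) of (z,y) \<Rightarrow> ?K z y)"
      using conv_integrable[OF f g] by (auto intro!: AE_I2)
    have "(\<lambda>z. \<integral>y. norm (case (z,y) of (z,y) \<Rightarrow> ?K z y) \<partial>lborel) =
      (\<lambda>z. on_pos (conv (\<lambda>x. \<bar>f x\<bar>) (\<lambda>x. \<bar>g x\<bar>)) z * on_pos (\<lambda>x. \<bar>h x\<bar>) (x - z))"
      unfolding on_pos_conv conv_on_pos by (auto simp: abs_mult oa)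
    then show "integrable lborel (\<lambda>z. \<integral>y. norm (case (z,y) of (z,y) \<Rightarrow> ?K z y) \<partial>lborel)"
      using conv_integrable[OF loc_int_conv[OF loc_int_abs[OF f] loc_int_abs[OF g]] loc_int_abs[OF h], of x]
      by simp
  qed
  have "conv (conv f g) h x = (\<integral>z. (\<integral>y. ?K z y \<partial>lborel) \<partial>lborel)"
    unfolding conv_on_pos[of "conv f g"] on_pos_conv by (simp add: conv_on_pos)
  also have "\<dots> = (\<integral>y. (\<integral>z. ?K z y \<partial>lborel) \<partial>lborel)"
    by (rule lborel_pair.Fubini_integral[symmetric]) (use I in \<open>simp add: case_prod_unfold\<close>)
  also have "\<dots> = (\<integral>y. on_pos f y * conv g h (x - y) \<partial>lborel)"
  proof (rule Bochner_Integration.integral_cong)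
    fix y
    have "(\<integral>z. ?K z y \<partial>lborel) = on_pos f y * (\<integral>z. on_pos g (z - y) * on_pos h (x - z) \<partial>lborel)"
      by (simp add: mult.assoc)
    also have "(\<integral>z. on_pos g (z - y) * on_pos h (x - z) \<partial>lborel) = conv g h (x - y)"
      unfolding conv_on_pos by (subst lborel_integral_real_affine[of 1 _ y]) (auto simp: algebra_simps)
    finally show "(\<integral>z. ?K z y \<partial>lborel) = on_pos f y * conv g h (x - y)" .
  qed simp
  also have "\<dots> = conv f (conv g h) x"
    unfolding conv_on_pos[of f] on_pos_conv ..
  finally show "conv (conv f g) h x = conv f (conv g h) x" .
qed

subsection \<open>The Euler operator\<close>

lemma dominated_convergence_at_right_0:
  fixes s :: "real \<Rightarrow> 'a \<Rightarrow> real"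
  assumes "f \<in> borel_measurable M" "\<And>\<epsilon>. 0 < \<epsilon> \<Longrightarrow> s \<epsilon> \<in> borel_measurable M" "integrable M w"
    and "AE x in M. ((\<lambda>\<epsilon>. s \<epsilon> x) \<longlongrightarrow> f x) (at_right 0)"
    and "\<And>\<epsilon>. 0 < \<epsilon> \<Longrightarrow> \<epsilon> < 1 \<Longrightarrow> AE x in M. \<bar>s \<epsilon> x\<bar> \<le> w x"
  shows "((\<lambda>\<epsilon>. integral\<^sup>L M (s \<epsilon>)) \<longlongrightarrow> integral\<^sup>L M f) (at_right 0)"
proof (rule tendsto_at_right_sequentially[of 0 1])
  \<comment> \<open>Sequences inside \<open>(0,1)\<close> suffice, which is why the bound is
    required for \<open>\<epsilon> < 1\<close> only.\<close>
  fix S :: "nat \<Rightarrow> real"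
  assume S: "\<And>n. 0 < S n" "\<And>n. S n < 1" "S \<longlonglongrightarrow> 0"
  then have lim: "filterlim S (at_right 0) sequentially"
    by (intro tendsto_imp_filterlim_at_right) auto
  show "(\<lambda>n. integral\<^sup>L M (s (S n))) \<longlonglongrightarrow> integral\<^sup>L M f"
  proof (rule integral_dominated_convergence[where w = w])
    show "AE x in M. (\<lambda>n. s (S n) x) \<longlonglongrightarrow> f x"
      using assms(4) by eventually_elim (rule filterlim_compose[OF _ lim])
  qed (use S assms in auto)
qed simp

lemma has_real_derivative_set_integral:
  assumes v: "continuous_on {0<..} v" and a: "0 < a" "a < x"
  shows "((\<lambda>x. LBINT y:{a<..<x}. v y) has_real_derivative v x) (at x)"
proof -
  have "((\<lambda>u. LBINT y=a..u. v y) has_vector_derivative v x) (at x within {a..x+1})"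
    by (rule interval_integral_FTC2) (use a in \<open>auto intro: continuous_on_subset[OF v]\<close>)
  then have "((\<lambda>u. LBINT y=a..u. v y) has_vector_derivative v x) (at x within {a<..<x+1})"
    by (rule has_vector_derivative_within_subset) auto
  then have "((\<lambda>u. LBINT y=a..u. v y) has_real_derivative v x) (at x)"
    using a by (subst (asm) has_vector_derivative_within_open)
      (auto simp: has_real_derivative_iff_has_vector_derivative)
  then show ?thesis
    by (rule has_field_derivative_transform_within_open[of _ _ _ "{a<..}"])
      (use a in \<open>auto simp: interval_lebesgue_integral_le_eq\<close>)
qed

lemma conv_one: "conv f (\<lambda>_. 1) x = (LBINT y:{0<..<x}. f y)"
  by (simp add: conv_def)

text \<open>The possible singularity at \<open>0\<close> sits in the integral over
  \<open>(0,a]\<close>, which does not depend on the upper limit; the rest is the fundamental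
  theorem of calculus.\<close>

lemma conv_one_has_real_derivative:
  assumes f: "loc_int f" and x: "0 < x"
  shows "(conv f (\<lambda>_. 1) has_real_derivative f x) (at x)"
proof -
  define a where "a = x / 2"
  have a: "0 < a" "a < x" using x by (auto simp: a_def)
  have "((\<lambda>t. (LBINT y:{0<..a}. f y) + (LBINT y:{a<..<t}. f y)) has_real_derivative 0 + f x) (at x)"
    by (intro DERIV_add DERIV_const has_real_derivative_set_integral a)
      (use f in \<open>simp add: loc_int_def\<close>)
  then have "((\<lambda>t. (LBINT y:{0<..a}. f y) + (LBINT y:{a<..<t}. f y)) has_real_derivative f x) (at x)"
    by simp
  then show ?thesis
  proof (rule has_field_derivative_transform_within_open[of _ _ _ "{a<..}"])
    fix t assume t: "t \<in> {a<..}"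
    have i: "set_integrable lborel {0<..<t} f" using f t a by (auto simp: loc_int_def)
    have "conv f (\<lambda>_. 1) t = (LBINT y:{0<..a} \<union> {a<..<t}. f y)"
      unfolding conv_one using t a by (intro arg_cong2[where f="set_lebesgue_integral lborel"]) auto
    also have "\<dots> = (LBINT y:{0<..a}. f y) + (LBINT y:{a<..<t}. f y)"
      by (intro set_integral_Un set_integrable_subset[OF i]) (use t a in auto)
    finally show "(LBINT y:{0<..a}. f y) + (LBINT y:{a<..<t}. f y) = conv f (\<lambda>_. 1) t" ..
  qed (use a in auto)
qed

lemma conv_one_tendsto_0:
  assumes f: "loc_int f"
  shows "(conv f (\<lambda>_. 1) \<longlongrightarrow> 0) (at_right 0)"
proof -
  note [measurable] = loc_int_measurable[OF f]
  have "((\<lambda>x. \<integral>y. indicator {0<..<x} y * on_pos f y \<partial>lborel) \<longlongrightarrow> (\<integral>y. 0 \<partial>(lborel :: real measure))) (at_right 0)"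
  proof (rule dominated_convergence_at_right_0)
    show "integrable lborel (\<lambda>y. \<bar>indicator {0<..<1} y * on_pos f y\<bar>)"
      by (intro integrable_abs loc_int_trunc f)
    show "AE y in lborel. ((\<lambda>x. indicator {0<..<x} y * on_pos f y) \<longlongrightarrow> 0) (at_right 0)"
    proof (rule AE_I2)
      fix y :: real
      have "eventually (\<lambda>x. indicator {0<..<x} y * on_pos f y = 0) (at_right 0)"
      proof (cases "0 < y")
        case True
        then have "eventually (\<lambda>x. x < y) (at_right 0)" by (auto simp: eventually_at_right)
        then show ?thesis by eventually_elim auto
      qed simp
      then show "((\<lambda>x. indicator {0<..<x} y * on_pos f y) \<longlongrightarrow> 0) (at_right 0)"
        by (rule tendsto_eventually)
    qed
  qed (auto split: split_indicator)
  moreover have "(\<integral>y. indicator {0<..<x} y * on_pos f y \<partial>lborel) = conv f (\<lambda>_. 1) x" for x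
    unfolding conv_one set_lebesgue_integral_def
    by (intro Bochner_Integration.integral_cong) (auto simp: on_pos_def split: split_indicator)
  ultimately show ?thesis by simp
qed

text \<open>
  \<open>euler f g\<close> says that \<open>g = (x f)'\<close> and that \<open>x f(x)\<close> vanishes at \<open>0\<close>, written as an identity of
  convolutions so that it can be multiplied by further convolution factors.
\<close>

definition euler :: "(real \<Rightarrow> real) \<Rightarrow> (real \<Rightarrow> real) \<Rightarrow> bool" where
  "euler f g \<longleftrightarrow> loc_int f \<and> loc_int g \<and> (\<forall>x>0. x * f x = conv g (\<lambda>_. 1) x)"

text \<open>Differentiation fixes \<open>x * f x\<close> only up to a constant. Integrability of
  \<open>f\<close> at \<open>0\<close> excludes a nonzero one, so applications need not compute the
  limit of \<open>x * f x\<close> at \<open>0\<close>.\<close>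

lemma euler_intro:
  assumes f: "loc_int f" and g: "loc_int g"
    and deriv: "\<And>x. 0 < x \<Longrightarrow> ((\<lambda>x. x * f x) has_real_derivative g x) (at x)"
  shows "euler f g"
proof -
  have "\<exists>C. \<forall>x\<in>{0<..}. x * f x - conv g (\<lambda>_. 1) x = C"
  proof (rule has_field_derivative_zero_constant)
    fix x :: real assume "x \<in> {0<..}"
    then have "((\<lambda>x. x * f x - conv g (\<lambda>_. 1) x) has_real_derivative g x - g x) (at x)"
      by (intro DERIV_diff deriv conv_one_has_real_derivative g) auto
    then show "((\<lambda>x. x * f x - conv g (\<lambda>_. 1) x) has_real_derivative 0) (at x within {0<..})"
      by (simp add: has_field_derivative_at_within)
  qed (rule convex_real_interval)
  then obtain C where C: "\<And>x. 0 < x \<Longrightarrow> x * f x = C + conv g (\<lambda>_. 1) x"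
    by (force simp: algebra_simps)
  \<comment> \<open>otherwise \<open>f / C\<close> exceeds \<open>1 / (2 x)\<close> near \<open>0\<close>, which is not integrable\<close>
  have "C = 0"
  proof (rule ccontr)
    assume nz: "C \<noteq> 0"
    define h where "h = (\<lambda>x. (1 / C) * f x)"
    define \<phi> where "\<phi> = conv h (\<lambda>_. 1)"
    have h: "loc_int h" unfolding h_def by (intro loc_int_cmult f)
    have "((\<lambda>x. 1 + conv g (\<lambda>_. 1) x / C) \<longlongrightarrow> 1 + 0 / C) (at_right 0)"
      using nz by (intro tendsto_intros conv_one_tendsto_0 g)
    then have "eventually (\<lambda>x. 1/2 < 1 + conv g (\<lambda>_. 1) x / C) (at_right 0)"
      by (intro order_tendstoD(1)) auto
    then obtain \<delta> where \<delta>: "0 < \<delta>" "\<And>x. 0 < x \<Longrightarrow> x < \<delta> \<Longrightarrow> 1/2 < 1 + conv g (\<lambda>_. 1) x / C"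
      by (auto simp: eventually_at_right_field)
    have hx: "1 / (2 * x) \<le> h x" if "0 < x" "x < \<delta>" for x
    proof -
      have "x * h x = 1 + conv g (\<lambda>_. 1) x / C"
        using C[OF that(1)] nz by (simp add: h_def field_simps)
      with \<delta>(2)[OF that] that show ?thesis by (simp add: field_simps)
    qed
    \<comment> \<open>By \<open>hx\<close> the derivative of \<open>\<phi>\<close> is at least
      \<open>1 / (2 * x)\<close>, so \<open>\<psi>\<close> increases up to
      \<open>\<delta> / 2\<close>; yet near \<open>0\<close> the term \<open>- ln x / 2\<close>
      tends to infinity while \<open>\<phi>\<close> tends to \<open>0\<close>.\<close>
    define \<psi> where "\<psi> = (\<lambda>x. \<phi> x - ln x / 2)"
    have mono: "\<psi> x \<le> \<psi> (\<delta> / 2)" if "0 < x" "x < \<delta> / 2" for x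
    proof (rule DERIV_nonneg_imp_nondecreasing[where f = \<psi>])
      fix t assume t: "x \<le> t" "t \<le> \<delta> / 2"
      have "(\<psi> has_real_derivative h t - (1 / t) / 2) (at t)"
        unfolding \<psi>_def \<phi>_def using t that
        by (intro DERIV_diff conv_one_has_real_derivative h DERIV_cdivide DERIV_ln_divide) auto
      moreover have "0 \<le> h t - (1 / t) / 2" using hx[of t] t that \<delta>(1) by simp
      ultimately show "\<exists>y. (\<psi> has_real_derivative y) (at t) \<and> 0 \<le> y" by blast
    qed (use that in simp)
    have "eventually (\<lambda>x. -1 < \<phi> x) (at_right 0)"
      unfolding \<phi>_def by (rule order_tendstoD(1)[OF conv_one_tendsto_0[OF h]]) simp
    \<comment> \<open>Together with \<open>-1 < \<phi> x\<close> this threshold gives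
      \<open>\<psi> x > \<psi> (\<delta> / 2)\<close>, against \<open>mono\<close>.\<close>
    moreover have "eventually (\<lambda>x. ln x < 2 * (- 1 - \<psi> (\<delta> / 2))) (at_right 0)"
      using ln_at_0 by (auto simp: filterlim_at_bot_dense)
    moreover have "eventually (\<lambda>x. 0 < x \<and> x < \<delta> / 2) (at_right 0)"
      using \<delta>(1) by (auto simp: eventually_at_right_field intro!: exI[of _ "\<delta>/2"])
    ultimately have "eventually (\<lambda>x. False) (at_right (0::real))"
    proof eventually_elim
      case (elim x)
      then show ?case using mono[of x] by (simp add: \<psi>_def)
    qed
    then show False by simp
  qed
  with C f g show ?thesis by (simp add: euler_def)
qed

text \<open>On the half-line \<open>f\<close> is the antiderivative of \<open>g\<close> divided by
  \<open>x\<close>, so its differentiability is a conclusion, by the quotient rule.\<close>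

lemma euler_has_real_derivative:
  assumes "euler f g" "0 < x"
  shows "(f has_real_derivative (g x - f x) / x) (at x)"
proof -
  have g: "loc_int g" and eq: "\<And>x. 0 < x \<Longrightarrow> x * f x = conv g (\<lambda>_. 1) x"
    using assms by (auto simp: euler_def)
  have "((\<lambda>t. conv g (\<lambda>_. 1) t / t) has_real_derivative
      (g x * x - conv g (\<lambda>_. 1) x * 1) / (x * x)) (at x)"
    using assms(2) by (intro DERIV_divide conv_one_has_real_derivative g DERIV_ident) auto
  moreover have "(g x * x - conv g (\<lambda>_. 1) x * 1) / (x * x) = (g x - f x) / x"
    using assms(2) by (simp add: eq[symmetric] field_simps)
  ultimately have "((\<lambda>t. conv g (\<lambda>_. 1) t / t) has_real_derivative (g x - f x) / x) (at x)" by simp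
  then show ?thesis
    by (rule has_field_derivative_transform_within_open[of _ _ _ "{0<..}"])
      (use assms(2) in \<open>auto simp: eq[symmetric]\<close>)
qed

lemma euler_add: "euler f f1 \<Longrightarrow> euler g g1 \<Longrightarrow> euler (\<lambda>x. f x + g x) (\<lambda>x. f1 x + g1 x)"
  by (simp add: euler_def loc_int_add conv_add_left loc_int_const distrib_left)

lemma euler_cmult: "euler f f1 \<Longrightarrow> euler (\<lambda>x. c * f x) (\<lambda>x. c * f1 x)"
  by (simp add: euler_def loc_int_cmult conv_cmult_left mult.left_commute)

text \<open>Writing \<open>x = y + (x - y)\<close> under the integral gives the Leibniz rule for
  multiplication by \<open>x\<close>; commutativity and associativity then pull the factor
  \<open>1\<close> out of each term.\<close>

lemma euler_conv:
  assumes "euler f f1" "euler g g1"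
  shows "euler (conv f g) (\<lambda>x. conv f1 g x + conv f g1 x)"
proof -
  have f: "loc_int f" "loc_int f1" "\<And>x. 0 < x \<Longrightarrow> x * f x = conv f1 (\<lambda>_. 1) x"
   and g: "loc_int g" "loc_int g1" "\<And>x. 0 < x \<Longrightarrow> x * g x = conv g1 (\<lambda>_. 1) x"
    using assms by (auto simp: euler_def)
  have one: "loc_int (\<lambda>_. 1)" by (rule loc_int_const)
  have xf: "loc_int (\<lambda>x. x * f x)" by (rule loc_int_cong[OF loc_int_conv[OF f(2) one] f(3)])
  have xg: "loc_int (\<lambda>x. x * g x)" by (rule loc_int_cong[OF loc_int_conv[OF g(2) one] g(3)])
  have "x * conv f g x = conv (\<lambda>x. conv f1 g x + conv f g1 x) (\<lambda>_. 1) x" for x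
  proof -
    have "x * conv f g x = (LBINT y:{0<..<x}. y * f y * g (x - y) + f y * ((x - y) * g (x - y)))"
      by (simp add: conv_def set_lebesgue_integral_def algebra_simps flip: integral_mult_right_zero)
    also have "\<dots> = conv (\<lambda>x. x * f x) g x + conv f (\<lambda>x. x * g x) x"
      unfolding conv_def
      by (rule set_integral_add(2)[OF conv_set_integrable[OF xf g(1)] conv_set_integrable[OF f(1) xg]])
    also have "conv (\<lambda>x. x * f x) g = conv (conv f1 (\<lambda>_. 1)) g"
      by (rule conv_cong) (auto simp: f)
    also have "conv (conv f1 (\<lambda>_. 1)) g = conv (conv f1 g) (\<lambda>_. 1)"
      by (simp add: conv_assoc f g one conv_commute[of g])
    also have "conv f (\<lambda>x. x * g x) = conv f (conv g1 (\<lambda>_. 1))"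
      by (rule conv_cong) (auto simp: g)
    also have "\<dots> = conv (conv f g1) (\<lambda>_. 1)"
      by (simp add: conv_assoc f g one)
    finally show ?thesis
      by (simp add: conv_add_left loc_int_conv f g one)
  qed
  then show ?thesis
    by (simp add: euler_def loc_int_conv loc_int_add f g)
qed

section \<open>Convolution powers\<close>

lemma conv_pow_Suc: "1 \<le> k \<Longrightarrow> conv_pow f (Suc k) = conv (conv_pow f k) f"
  by (cases k) auto

lemma loc_int_conv_pow:
  assumes "loc_int f" "1 \<le> k"
  shows "loc_int (conv_pow f k)"
  using assms(2)
proof (induction k rule: dec_induct)
  case (step k)
  then show ?case using assms(1) by (simp add: conv_pow_Suc loc_int_conv)
qed (use assms in simp)

lemma conv_pow_defined:
  assumes "loc_int f" "1 \<le> k"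
  shows "conv_pow_defined f k x"
  using assms(2)
proof (induction k arbitrary: x rule: dec_induct)
  case (step k)
  then obtain j where "k = Suc j" by (cases k) auto
  then show ?case
    using step conv_set_integrable[OF loc_int_conv_pow[OF assms(1), of k] assms(1)] by simp
qed simp

subsection \<open>Families converging as the damping vanishes\<close>

text \<open>
  Families are indexed by \<open>\<epsilon> \<ge> 0\<close>, and the member at \<open>\<epsilon> = 0\<close> is the limit; this fits \<open>damped u 0 = u\<close>.
\<close>

definition dom_family :: "(real \<Rightarrow> real \<Rightarrow> real) \<Rightarrow> bool" where
  "dom_family f \<longleftrightarrow> (\<forall>\<epsilon>\<ge>0. loc_int (f \<epsilon>)) \<and>
     (\<exists>B. loc_int B \<and> (\<forall>\<epsilon>\<ge>0. \<forall>x>0. \<bar>f \<epsilon> x\<bar> \<le> B x)) \<and>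
     (\<forall>x>0. ((\<lambda>\<epsilon>. f \<epsilon> x) \<longlongrightarrow> f 0 x) (at_right 0))"

lemma dom_familyI:
  assumes "\<And>\<epsilon>. 0 \<le> \<epsilon> \<Longrightarrow> continuous_on {0<..} (f \<epsilon>)" "loc_int B"
    and "\<And>\<epsilon> x. 0 \<le> \<epsilon> \<Longrightarrow> 0 < x \<Longrightarrow> \<bar>f \<epsilon> x\<bar> \<le> B x"
    and "\<And>x. 0 < x \<Longrightarrow> ((\<lambda>\<epsilon>. f \<epsilon> x) \<longlongrightarrow> f 0 x) (at_right 0)"
  shows "dom_family f"
  using assms loc_int_dominated[OF assms(1,2,3)] by (auto simp: dom_family_def)

lemma dom_family_loc_int: "dom_family f \<Longrightarrow> 0 \<le> \<epsilon> \<Longrightarrow> loc_int (f \<epsilon>)"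
  by (simp add: dom_family_def)

lemma dom_family_add:
  assumes "dom_family f" "dom_family g"
  shows "dom_family (\<lambda>\<epsilon> x. f \<epsilon> x + g \<epsilon> x)"
proof -
  obtain B B' where B: "loc_int B" "\<forall>\<epsilon>\<ge>0. \<forall>x>0. \<bar>f \<epsilon> x\<bar> \<le> B x" "loc_int B'" "\<forall>\<epsilon>\<ge>0. \<forall>x>0. \<bar>g \<epsilon> x\<bar> \<le> B' x"
    using assms by (auto simp: dom_family_def)
  have "\<bar>f \<epsilon> x + g \<epsilon> x\<bar> \<le> B x + B' x" if "0 \<le> \<epsilon>" "0 < x" for \<epsilon> x
    using B(2,4) that by (intro order_trans[OF abs_triangle_ineq] add_mono) auto
  moreover have "loc_int (\<lambda>x. B x + B' x)" by (intro loc_int_add B)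
  ultimately show ?thesis
    using assms by (auto simp: dom_family_def intro!: loc_int_add tendsto_add)
qed

lemma dom_family_cmult:
  assumes "dom_family f"
  shows "dom_family (\<lambda>\<epsilon> x. c * f \<epsilon> x)"
proof -
  obtain B where B: "loc_int B" "\<forall>\<epsilon>\<ge>0. \<forall>x>0. \<bar>f \<epsilon> x\<bar> \<le> B x"
    using assms by (auto simp: dom_family_def)
  have "\<bar>c * f \<epsilon> x\<bar> \<le> \<bar>c\<bar> * B x" if "0 \<le> \<epsilon>" "0 < x" for \<epsilon> x
    using B(2) that by (simp add: abs_mult mult_left_mono)
  moreover have "loc_int (\<lambda>x. \<bar>c\<bar> * B x)" by (intro loc_int_cmult B)
  ultimately show ?thesis
    using assms unfolding dom_family_def
    by (intro conjI) (auto intro!: loc_int_cmult tendsto_mult_left exI[of _ "\<lambda>x. \<bar>c\<bar> * B x"])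
qed

text \<open>The convolution of the two majorants is a majorant, and for fixed \<open>x\<close> its
  integrand is the one that dominated convergence asks for.\<close>

lemma dom_family_conv:
  assumes f: "dom_family f" and g: "dom_family g"
  shows "dom_family (\<lambda>\<epsilon>. conv (f \<epsilon>) (g \<epsilon>))"
proof -
  obtain A B where A: "loc_int A" "\<And>\<epsilon> x. 0 \<le> \<epsilon> \<Longrightarrow> 0 < x \<Longrightarrow> \<bar>f \<epsilon> x\<bar> \<le> A x"
    and B: "loc_int B" "\<And>\<epsilon> x. 0 \<le> \<epsilon> \<Longrightarrow> 0 < x \<Longrightarrow> \<bar>g \<epsilon> x\<bar> \<le> B x"
    using assms by (auto simp: dom_family_def)
  have li: "loc_int (f \<epsilon>)" "loc_int (g \<epsilon>)" if "0 \<le> \<epsilon>" for \<epsilon>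
    using f g that by (auto simp: dom_family_def)
  have bd: "\<bar>on_pos (f \<epsilon>) y * on_pos (g \<epsilon>) (x - y)\<bar> \<le> on_pos A y * on_pos B (x - y)"
    if "0 \<le> \<epsilon>" for \<epsilon> x y
    using A(2)[OF that, of y] B(2)[OF that, of "x - y"]
    by (auto simp: on_pos_def abs_mult intro!: mult_mono)
  show ?thesis
  proof (rule dom_familyI)
    show "continuous_on {0<..} (conv (f \<epsilon>) (g \<epsilon>))" if "0 \<le> \<epsilon>" for \<epsilon>
      by (intro continuous_on_conv li that)
    show "loc_int (conv A B)" by (intro loc_int_conv A B)
    show "\<bar>conv (f \<epsilon>) (g \<epsilon>) x\<bar> \<le> conv A B x" if "0 \<le> \<epsilon>" for \<epsilon> x
    proof -
      have "\<bar>conv (f \<epsilon>) (g \<epsilon>) x\<bar> \<le> (\<integral>y. \<bar>on_pos (f \<epsilon>) y * on_pos (g \<epsilon>) (x - y)\<bar> \<partial>lborel)"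
        unfolding conv_on_pos by (rule integral_abs_bound)
      also have "\<dots> \<le> conv A B x"
        unfolding conv_on_pos
        by (intro integral_mono integrable_abs conv_integrable li that A B bd)
      finally show ?thesis .
    qed
    show "((\<lambda>\<epsilon>. conv (f \<epsilon>) (g \<epsilon>) x) \<longlongrightarrow> conv (f 0) (g 0) x) (at_right 0)" for x
      unfolding conv_on_pos
    proof (rule dominated_convergence_at_right_0)
      show "(\<lambda>y. on_pos (f 0) y * on_pos (g 0) (x - y)) \<in> borel_measurable lborel"
        using conv_integrable[OF li[of 0]] by auto
      show "(\<lambda>y. on_pos (f \<epsilon>) y * on_pos (g \<epsilon>) (x - y)) \<in> borel_measurable lborel" if "0 < \<epsilon>" for \<epsilon>
        using conv_integrable[OF li[of \<epsilon>]] that by auto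
      show "integrable lborel (\<lambda>y. on_pos A y * on_pos B (x - y))"
        by (intro conv_integrable A B)
      show "AE y in lborel. ((\<lambda>\<epsilon>. on_pos (f \<epsilon>) y * on_pos (g \<epsilon>) (x - y)) \<longlongrightarrow>
          on_pos (f 0) y * on_pos (g 0) (x - y)) (at_right 0)"
        using f g by (intro AE_I2 tendsto_mult) (auto simp: on_pos_def dom_family_def)
    qed (use bd in auto)
  qed
qed

text \<open>Counts how often the Euler operator can be applied, with one witness family for all
  \<open>\<epsilon>\<close>, so that domination and convergence are kept at every level.\<close>

primrec euler_family :: "nat \<Rightarrow> (real \<Rightarrow> real \<Rightarrow> real) \<Rightarrow> bool" where
  "euler_family 0 f \<longleftrightarrow> dom_family f"
| "euler_family (Suc N) f \<longleftrightarrow>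
     dom_family f \<and> (\<exists>f1. (\<forall>\<epsilon>\<ge>0. euler (f \<epsilon>) (f1 \<epsilon>)) \<and> euler_family N f1)"

lemma euler_family_dom: "euler_family N f \<Longrightarrow> dom_family f"
  by (cases N) auto

lemma euler_family_Suc_imp: "euler_family (Suc N) f \<Longrightarrow> euler_family N f"
  by (induction N arbitrary: f) auto

lemma euler_family_add:
  "euler_family N f \<Longrightarrow> euler_family N g \<Longrightarrow> euler_family N (\<lambda>\<epsilon> x. f \<epsilon> x + g \<epsilon> x)"
proof (induction N arbitrary: f g)
  case (Suc N)
  then obtain f1 g1 where "\<forall>\<epsilon>\<ge>0. euler (f \<epsilon>) (f1 \<epsilon>)" "euler_family N f1"
    "\<forall>\<epsilon>\<ge>0. euler (g \<epsilon>) (g1 \<epsilon>)" "euler_family N g1" by auto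
  with Suc show ?case
    by (auto intro!: dom_family_add exI[of _ "\<lambda>\<epsilon> x. f1 \<epsilon> x + g1 \<epsilon> x"] euler_add)
qed (simp add: dom_family_add)

lemma euler_family_cmult: "euler_family N f \<Longrightarrow> euler_family N (\<lambda>\<epsilon> x. c * f \<epsilon> x)"
proof (induction N arbitrary: f)
  case (Suc N)
  then obtain f1 where "\<forall>\<epsilon>\<ge>0. euler (f \<epsilon>) (f1 \<epsilon>)" "euler_family N f1" by auto
  with Suc show ?case
    by (auto intro!: dom_family_cmult exI[of _ "\<lambda>\<epsilon> x. c * f1 \<epsilon> x"] euler_cmult)
qed (simp add: dom_family_cmult)

text \<open>Leibniz rule, level by level: in each summand one factor has \<open>N\<close> levels
  left, and the other gives up one of its \<open>Suc N\<close>.\<close>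

lemma euler_family_conv:
  "euler_family N f \<Longrightarrow> euler_family N g \<Longrightarrow> euler_family N (\<lambda>\<epsilon>. conv (f \<epsilon>) (g \<epsilon>))"
proof (induction N arbitrary: f g)
  case (Suc N)
  then obtain f1 g1 where 1: "\<forall>\<epsilon>\<ge>0. euler (f \<epsilon>) (f1 \<epsilon>)" "euler_family N f1"
    "\<forall>\<epsilon>\<ge>0. euler (g \<epsilon>) (g1 \<epsilon>)" "euler_family N g1" by auto
  have "euler_family N (\<lambda>\<epsilon> x. conv (f1 \<epsilon>) (g \<epsilon>) x + conv (f \<epsilon>) (g1 \<epsilon>) x)"
    using 1 by (intro euler_family_add Suc.IH Suc.prems[THEN euler_family_Suc_imp])
  moreover have "dom_family (\<lambda>\<epsilon>. conv (f \<epsilon>) (g \<epsilon>))"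
    using Suc.prems by (auto intro: dom_family_conv)
  ultimately show ?case
    using 1 by (auto intro!: exI[of _ "\<lambda>\<epsilon> x. conv (f1 \<epsilon>) (g \<epsilon>) x + conv (f \<epsilon>) (g1 \<epsilon>) x"] euler_conv)
qed (simp add: dom_family_conv)

lemma euler_family_conv_pow:
  assumes "euler_family N f" "1 \<le> k"
  shows "euler_family N (\<lambda>\<epsilon>. conv_pow (f \<epsilon>) k)"
  using assms(2)
  by (induction k rule: dec_induct)
    (use assms(1) in \<open>simp_all add: conv_pow_Suc euler_family_conv\<close>)

section \<open>From Euler operators to ordinary derivatives\<close>

definition ptwise_family :: "(real \<Rightarrow> real \<Rightarrow> real) \<Rightarrow> bool" where
  "ptwise_family f \<longleftrightarrow> (\<forall>\<epsilon>\<ge>0. continuous_on {0<..} (f \<epsilon>)) \<and>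
     (\<forall>x>0. ((\<lambda>\<epsilon>. f \<epsilon> x) \<longlongrightarrow> f 0 x) (at_right 0))"

text \<open>In contrast to \<open>euler_family\<close> nothing is dominated here: the division by
  \<open>x\<close> in \<open>f' = (\<theta> f - f) / x\<close> can destroy integrability at
  \<open>0\<close>, and the final limit is pointwise.\<close>

primrec smooth_family :: "nat \<Rightarrow> (real \<Rightarrow> real \<Rightarrow> real) \<Rightarrow> bool" where
  "smooth_family 0 f \<longleftrightarrow> ptwise_family f"
| "smooth_family (Suc N) f \<longleftrightarrow> ptwise_family f \<and>
     (\<exists>f1. (\<forall>\<epsilon>\<ge>0. \<forall>x>0. (f \<epsilon> has_real_derivative f1 \<epsilon> x) (at x)) \<and> smooth_family N f1)"

lemma smooth_family_Suc_imp: "smooth_family (Suc N) f \<Longrightarrow> smooth_family N f"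
  by (induction N arbitrary: f) auto

lemma smooth_family_diff:
  "smooth_family N f \<Longrightarrow> smooth_family N g \<Longrightarrow> smooth_family N (\<lambda>\<epsilon> x. f \<epsilon> x - g \<epsilon> x)"
proof (induction N arbitrary: f g)
  case 0
  then show ?case by (auto simp: ptwise_family_def intro!: continuous_intros tendsto_diff)
next
  case (Suc N)
  then obtain f1 g1 where "\<forall>\<epsilon>\<ge>0. \<forall>x>0. (f \<epsilon> has_real_derivative f1 \<epsilon> x) (at x)" "smooth_family N f1"
    "\<forall>\<epsilon>\<ge>0. \<forall>x>0. (g \<epsilon> has_real_derivative g1 \<epsilon> x) (at x)" "smooth_family N g1" by auto
  with Suc show ?case
    by (auto simp: ptwise_family_def intro!: exI[of _ "\<lambda>\<epsilon> x. f1 \<epsilon> x - g1 \<epsilon> x"] DERIV_diff continuous_intros tendsto_diff)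
qed

text \<open>Quotient rule. The term \<open>f \<epsilon> x / x / x\<close> is the division applied
  twice to \<open>f\<close>, which the induction covers because \<open>f\<close> also has
  \<open>N\<close> derivatives.\<close>

lemma smooth_family_div_id:
  "smooth_family N f \<Longrightarrow> smooth_family N (\<lambda>\<epsilon> x. f \<epsilon> x / x)"
proof (induction N arbitrary: f)
  case 0
  then show ?case by (auto simp: ptwise_family_def intro!: continuous_intros tendsto_divide)
next
  case (Suc N)
  then obtain f1 where f1: "\<forall>\<epsilon>\<ge>0. \<forall>x>0. (f \<epsilon> has_real_derivative f1 \<epsilon> x) (at x)" "smooth_family N f1"
    by auto
  let ?g = "\<lambda>\<epsilon> x. f1 \<epsilon> x / x - f \<epsilon> x / x / x"
  have "smooth_family N ?g"
    by (intro smooth_family_diff Suc.IH f1 smooth_family_Suc_imp[OF Suc.prems])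
  moreover have "((\<lambda>x. f \<epsilon> x / x) has_real_derivative ?g \<epsilon> x) (at x)" if "0 \<le> \<epsilon>" "0 < x" for \<epsilon> x
  proof -
    have "((\<lambda>x. f \<epsilon> x / x) has_real_derivative (f1 \<epsilon> x * x - f \<epsilon> x * 1) / (x * x)) (at x)"
      using f1 that by (intro DERIV_divide DERIV_ident) auto
    moreover have "(f1 \<epsilon> x * x - f \<epsilon> x * 1) / (x * x) = ?g \<epsilon> x"
      using that by (simp add: field_simps)
    ultimately show ?thesis by simp
  qed
  moreover have "ptwise_family (\<lambda>\<epsilon> x. f \<epsilon> x / x)"
    using Suc.prems by (auto simp: ptwise_family_def intro!: continuous_intros tendsto_divide)
  ultimately show ?case by (auto intro!: exI[of _ ?g])
qed

lemma euler_family_imp_smooth: "euler_family N f \<Longrightarrow> smooth_family N f"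
proof (induction N arbitrary: f)
  case 0
  then show ?case by (auto simp: ptwise_family_def dom_family_def loc_int_def)
next
  case (Suc N)
  then obtain f1 where f1: "\<forall>\<epsilon>\<ge>0. euler (f \<epsilon>) (f1 \<epsilon>)" "euler_family N f1" by auto
  have "smooth_family N (\<lambda>\<epsilon> x. (f1 \<epsilon> x - f \<epsilon> x) / x)"
    by (intro smooth_family_div_id smooth_family_diff Suc.IH f1 euler_family_Suc_imp[OF Suc.prems])
  moreover have "ptwise_family f"
    using Suc.prems by (auto simp: ptwise_family_def dom_family_def loc_int_def)
  ultimately show ?case
    using f1 by (auto intro!: exI[of _ "\<lambda>\<epsilon> x. (f1 \<epsilon> x - f \<epsilon> x) / x"] euler_has_real_derivative)
qed

section \<open>Iterated \<open>deriv\<close> for functions compared only on the open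
  half-line\<close>

lemma deriv_cong_pos:
  assumes "\<And>x::real. 0 < x \<Longrightarrow> f x = g x" "0 < x"
  shows "deriv f x = deriv g x"
proof (rule deriv_cong_ev)
  show "eventually (\<lambda>x. f x = g x) (nhds x)"
    using eventually_nhds_in_open[of "{0<..}" x] assms(2)
    by (auto elim!: eventually_mono simp: assms(1))
qed simp

lemma deriv_funpow_cong_pos:
  assumes "\<And>x::real. 0 < x \<Longrightarrow> f x = g x" "0 < x"
  shows "(deriv ^^ k) f x = (deriv ^^ k) g x"
  using assms(2)
proof (induction k arbitrary: x)
  case (Suc k)
  then show ?case by (auto intro: deriv_cong_pos)
qed (use assms in simp)

text \<open>Peels off the innermost derivative, in step with the recursion of
  \<open>smooth_family\<close>.\<close>

lemma deriv_funpow_Suc_pos: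
  assumes "\<And>x. 0 < x \<Longrightarrow> (f has_real_derivative f1 x) (at x)" "0 < x"
  shows "(deriv ^^ Suc k) f x = (deriv ^^ k) f1 x"
  unfolding funpow_Suc_right comp_def
  by (rule deriv_funpow_cong_pos) (auto intro: DERIV_imp_deriv assms)

lemma cont_diff_pos_Suc:
  assumes "\<And>x. 0 < x \<Longrightarrow> (f has_real_derivative f1 x) (at x)" "cont_diff_pos N f1"
  shows "cont_diff_pos (Suc N) f"
  unfolding cont_diff_pos_def
proof (intro conjI allI impI)
  fix k and x :: real assume kx: "k < Suc N" "0 < x"
  show "(deriv ^^ k) f differentiable at x"
  proof (cases k)
    case 0
    then show ?thesis using assms(1)[OF kx(2)] by (auto simp: real_differentiable_def)
  next
    case (Suc j)
    then have "(deriv ^^ j) f1 differentiable at x"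
      using assms(2) kx by (auto simp: cont_diff_pos_def)
    then obtain D where "((deriv ^^ j) f1 has_real_derivative D) (at x)"
      by (auto simp: real_differentiable_def)
    then have "((deriv ^^ Suc j) f has_real_derivative D) (at x)"
      by (rule has_field_derivative_transform_within_open[of _ _ _ "{0<..}"])
        (use kx deriv_funpow_Suc_pos[of f f1 _ j] assms(1) in auto)
    then show ?thesis unfolding Suc by (auto simp: real_differentiable_def)
  qed
next
  have "continuous_on {0<..} ((deriv ^^ Suc N) f) = continuous_on {0<..} ((deriv ^^ N) f1)"
    by (rule continuous_on_cong) (use deriv_funpow_Suc_pos[of f f1 _ N] assms(1) in auto)
  then show "continuous_on {0<..} ((deriv ^^ Suc N) f)"
    using assms(2) by (simp add: cont_diff_pos_def)
qed

lemma smooth_family_cont_diff_pos: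
  "smooth_family N f \<Longrightarrow> 0 \<le> \<epsilon> \<Longrightarrow> cont_diff_pos N (f \<epsilon>)"
proof (induction N arbitrary: f)
  case 0
  then show ?case by (simp add: cont_diff_pos_def ptwise_family_def)
next
  case (Suc N)
  then obtain f1 where "\<forall>\<epsilon>\<ge>0. \<forall>x>0. (f \<epsilon> has_real_derivative f1 \<epsilon> x) (at x)" "smooth_family N f1"
    by auto
  with Suc show ?case by (intro cont_diff_pos_Suc[of _ "f1 \<epsilon>"]) auto
qed

lemma smooth_family_deriv_tendsto:
  "smooth_family N f \<Longrightarrow> 0 < x \<Longrightarrow>
    ((\<lambda>\<epsilon>. (deriv ^^ N) (f \<epsilon>) x) \<longlongrightarrow> (deriv ^^ N) (f 0) x) (at_right 0)"
proof (induction N arbitrary: f)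
  case 0
  then show ?case by (simp add: ptwise_family_def)
next
  case (Suc N)
  then obtain f1 where f1: "\<And>\<epsilon> x. 0 \<le> \<epsilon> \<Longrightarrow> 0 < x \<Longrightarrow> (f \<epsilon> has_real_derivative f1 \<epsilon> x) (at x)"
    "smooth_family N f1" by auto
  have eq: "(deriv ^^ Suc N) (f \<epsilon>) x = (deriv ^^ N) (f1 \<epsilon>) x" if "0 \<le> \<epsilon>" for \<epsilon>
    by (rule deriv_funpow_Suc_pos) (use f1 that Suc.prems in auto)
  have "eventually (\<lambda>\<epsilon>. (deriv ^^ N) (f1 \<epsilon>) x = (deriv ^^ Suc N) (f \<epsilon>) x) (at_right 0)"
    using eventually_at_right_less[of 0] by eventually_elim (simp add: eq del: funpow.simps)
  moreover have "((\<lambda>\<epsilon>. (deriv ^^ N) (f1 \<epsilon>) x) \<longlongrightarrow> (deriv ^^ Suc N) (f 0) x) (at_right 0)"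
    using Suc.IH[OF f1(2) Suc.prems(2)] by (simp only: eq order_refl)
  ultimately show ?case by (rule Lim_transform_eventually[rotated])
qed

subsection \<open>Iterated derivatives for a finite measure\<close>

lemma conv_pow_cong:
  assumes "\<And>x. 0 < x \<Longrightarrow> f x = g x" "1 \<le> k" "0 < x"
  shows "conv_pow f k x = conv_pow g k x"
  using assms(2,3)
proof (induction k arbitrary: x rule: dec_induct)
  case (step k)
  then show ?case by (metis assms(1) conv_cong conv_pow_Suc)
qed (use assms in simp)

text \<open>Convolution with the signed measure \<open>c \<delta>\<^sub>0 - v(x) dx\<close>.\<close>

definition point_mass_minus :: "real \<Rightarrow> (real \<Rightarrow> real) \<Rightarrow> (real \<Rightarrow> real) \<Rightarrow> real \<Rightarrow> real" where
  "point_mass_minus c v h = (\<lambda>x. c * h x - conv h v x)"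

lemma loc_int_point_mass_minus:
  "loc_int v \<Longrightarrow> loc_int h \<Longrightarrow> loc_int (point_mass_minus c v h)"
  unfolding point_mass_minus_def by (intro loc_int_diff loc_int_cmult loc_int_conv)

text \<open>Pascal's rule; the first sum may be extended to \<open>Suc n\<close> because
  \<open>n choose Suc n\<close> is \<open>0\<close>.\<close>

lemma binomial_shift_sum:
  fixes a :: "nat \<Rightarrow> real"
  shows "(\<Sum>i\<le>n. real (n choose i) * c ^ (Suc n - i) * a i) + (\<Sum>i\<le>n. real (n choose i) * c ^ (n - i) * a (Suc i))
    = (\<Sum>i\<le>Suc n. real (Suc n choose i) * c ^ (Suc n - i) * a i)"
proof -
  have "(\<Sum>i\<le>Suc n. real (n choose i) * c ^ (Suc n - i) * a i) =
      c ^ Suc n * a 0 + (\<Sum>i\<le>n. real (n choose Suc i) * c ^ (n - i) * a (Suc i))"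
    by (subst sum.atMost_Suc_shift) simp
  moreover have "(\<Sum>i\<le>Suc n. real (Suc n choose i) * c ^ (Suc n - i) * a i) =
      c ^ Suc n * a 0 + (\<Sum>i\<le>n. real (Suc n choose Suc i) * c ^ (n - i) * a (Suc i))"
    by (subst sum.atMost_Suc_shift) simp
  ultimately show ?thesis
    by (simp add: distrib_right sum.distrib binomial_eq_0)
qed

section \<open>The operator \<open>T h = c h - h * v\<close> and its powers\<close>

context
  fixes v :: "real \<Rightarrow> real" and c :: real
  assumes v: "loc_int v"
begin

private abbreviation T where "T \<equiv> point_mass_minus c v"
private abbreviation U where "U \<equiv> \<lambda>h. conv h v"
private abbreviation G where "G \<equiv> T (\<lambda>_. 1)"

private lemma loc_int_U_funpow: "loc_int h \<Longrightarrow> loc_int ((U ^^ n) h)"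
  by (induction n) (auto intro: loc_int_conv v)

private lemma loc_int_G: "loc_int G"
  by (intro loc_int_point_mass_minus v loc_int_const)

private lemma loc_int_conv_G_funpow: "loc_int h \<Longrightarrow> loc_int (((\<lambda>g. conv g G) ^^ n) h)"
  by (induction n) (auto intro: loc_int_conv loc_int_G)

text \<open>\<open>G\<close> is \<open>T\<close> applied to the constant \<open>1\<close>, and
  \<open>T\<close> can be moved from one convolution factor to the other. Consequently the
  derivative of \<open>conv h G\<close> is \<open>T h\<close>.\<close>

lemma conv_point_mass_minus_one:
  assumes h: "loc_int h"
  shows "conv h G = conv (T h) (\<lambda>_. 1)"
proof -
  have one: "loc_int (\<lambda>_. 1)" by (rule loc_int_const)
  have "conv h G = conv (\<lambda>x. c * 1 - conv (\<lambda>_. 1) v x) h"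
    by (subst conv_commute) (simp add: point_mass_minus_def)
  also have "\<dots> = (\<lambda>x. conv (\<lambda>x. c * 1) h x - conv (conv (\<lambda>_. 1) v) h x)"
    by (intro conv_diff_left loc_int_cmult loc_int_conv one v h)
  also have "conv (\<lambda>x. c * 1) h = (\<lambda>x. c * conv h (\<lambda>_. 1) x)"
    by (subst conv_cmult_left) (simp add: conv_commute)
  also have "conv (conv (\<lambda>_. 1) v) h = conv (conv h v) (\<lambda>_. 1)"
    by (metis conv_assoc conv_commute one v h)
  also have "(\<lambda>x. c * conv h (\<lambda>_. 1) x - conv (conv h v) (\<lambda>_. 1) x) = conv (T h) (\<lambda>_. 1)"
    unfolding point_mass_minus_def
    by (subst conv_diff_left) (auto simp: conv_cmult_left intro!: loc_int_cmult loc_int_conv one v h)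
  finally show ?thesis .
qed

private lemma conv_G_commute_T:
  assumes h: "loc_int h"
  shows "conv (T h) G = T (conv h G)"
proof -
  have "conv (T h) G = (\<lambda>x. c * conv h G x - conv (conv h v) G x)"
    unfolding point_mass_minus_def[of c v h]
    by (subst conv_diff_left) (auto simp: conv_cmult_left intro!: loc_int_cmult loc_int_conv v h loc_int_G)
  also have "conv (conv h v) G = conv (conv h G) v"
    by (simp add: conv_assoc h v loc_int_G conv_commute[of v])
  finally show ?thesis by (simp add: point_mass_minus_def)
qed

private lemma T_conv_G_funpow:
  "loc_int h \<Longrightarrow> T (((\<lambda>g. conv g G) ^^ n) h) = ((\<lambda>g. conv g G) ^^ n) (T h)"
  by (induction n) (simp_all add: conv_G_commute_T[symmetric] loc_int_conv_G_funpow)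

text \<open>One derivative trades one factor \<open>G\<close> for one \<open>T\<close>, and
  \<open>T\<close> commutes with the remaining factors; the induction therefore continues with
  \<open>T h\<close> in place of \<open>h\<close>.\<close>

private lemma deriv_conv_G_funpow:
  "loc_int h \<Longrightarrow> 0 < x \<Longrightarrow> (deriv ^^ n) (((\<lambda>g. conv g G) ^^ n) h) x = (T ^^ n) h x"
proof (induction n arbitrary: h)
  case (Suc n)
  let ?g = "((\<lambda>g. conv g G) ^^ n) h"
  have g: "loc_int ?g" by (rule loc_int_conv_G_funpow[OF Suc.prems(1)])
  have "(conv ?g G has_real_derivative T ?g x) (at x)" if "0 < x" for x
    unfolding conv_point_mass_minus_one[OF g]
    by (intro conv_one_has_real_derivative loc_int_point_mass_minus v g that)
  then have "(deriv ^^ Suc n) (conv ?g G) x = (deriv ^^ n) (T ?g) x"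
    using Suc.prems(2) by (intro deriv_funpow_Suc_pos)
  also have "\<dots> = (T ^^ n) (T h) x"
    unfolding T_conv_G_funpow[OF Suc.prems(1)]
    by (intro Suc.IH loc_int_point_mass_minus v Suc.prems)
  finally show ?case by (simp add: funpow_swap1)
qed simp

text \<open>Binomial theorem: \<open>T\<close> is the difference of two commuting operators,
  multiplication by \<open>c\<close> and \<open>U\<close>.\<close>

private lemma T_funpow_expand:
  assumes h: "loc_int h"
  shows "(T ^^ n) h = (\<lambda>x. \<Sum>i\<le>n. real (n choose i) * c ^ (n - i) * ((-1) ^ i * (U ^^ i) h x))"
proof (induction n)
  case (Suc n)
  let ?a = "\<lambda>i x. (-1) ^ i * (U ^^ i) h x"
  have l: "loc_int (\<lambda>x. real (n choose i) * c ^ (n - i) * ?a i x)" for i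
    by (intro loc_int_cmult loc_int_U_funpow h)
  have "conv (\<lambda>x. \<Sum>i\<le>n. real (n choose i) * c ^ (n - i) * ?a i x) v =
      (\<lambda>x. \<Sum>i\<le>n. conv (\<lambda>x. real (n choose i) * c ^ (n - i) * ?a i x) v x)"
    using conv_sum_left[of "{..n}" "\<lambda>i x. real (n choose i) * c ^ (n - i) * ?a i x" v] l v by simp
  also have "\<dots> = (\<lambda>x. - (\<Sum>i\<le>n. real (n choose i) * c ^ (n - i) * ?a (Suc i) x))"
    by (simp add: conv_cmult_left sum_negf[symmetric])
  finally have cv: "conv (\<lambda>x. \<Sum>i\<le>n. real (n choose i) * c ^ (n - i) * ?a i x) v =
      (\<lambda>x. - (\<Sum>i\<le>n. real (n choose i) * c ^ (n - i) * ?a (Suc i) x))" .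
  have "(T ^^ Suc n) h = (\<lambda>x. c * (\<Sum>i\<le>n. real (n choose i) * c ^ (n - i) * ?a i x) +
       (\<Sum>i\<le>n. real (n choose i) * c ^ (n - i) * ?a (Suc i) x))"
    by (simp add: Suc.IH) (simp add: point_mass_minus_def cv)
  also have "\<dots> = (\<lambda>x. (\<Sum>i\<le>n. real (n choose i) * c ^ (Suc n - i) * ?a i x) +
       (\<Sum>i\<le>n. real (n choose i) * c ^ (n - i) * ?a (Suc i) x))"
    unfolding sum_distrib_left
    by (intro ext arg_cong2[where f="(+)"] sum.cong refl) (auto simp: Suc_diff_le)
  also have "\<dots> = (\<lambda>x. \<Sum>i\<le>Suc n. real (Suc n choose i) * c ^ (Suc n - i) * ?a i x)"
    by (intro ext binomial_shift_sum[of n c "\<lambda>i. ?a i x" for x])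
  finally show ?case .
qed simp

text \<open>Exhibits these functions as antiderivatives of convolution powers of \<open>v\<close>,
  ready for one more differentiation.\<close>

private lemma U_funpow_one: "1 \<le> i \<Longrightarrow> (U ^^ i) (\<lambda>_. 1) = conv (conv_pow v i) (\<lambda>_. 1)"
proof (induction i rule: dec_induct)
  case base
  then show ?case by (simp add: conv_commute)
next
  case (step i)
  have one: "loc_int (\<lambda>_. 1)" by (rule loc_int_const)
  have p: "loc_int (conv_pow v i)" by (rule loc_int_conv_pow[OF v step(1)])
  show ?case
    using step by (simp add: conv_pow_Suc conv_assoc p one v conv_commute[of "\<lambda>_. 1"])
qed

lemma deriv_conv_pow_point_mass_minus_one:
  assumes n: "1 \<le> n" and x: "0 < x"
  shows "(deriv ^^ n) (conv_pow G n) x =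
    (\<Sum>i=1..n. real (n choose i) * c ^ (n - i) * ((-1) ^ i * conv_pow v i x))"
proof -
  have one: "loc_int (\<lambda>_. 1)" by (rule loc_int_const)
  have cp: "conv_pow G (Suc j) = ((\<lambda>g. conv g G) ^^ j) G" for j
    by (induction j) simp_all
  obtain j where j: "n = Suc j" using n by (cases n) auto
  \<comment> \<open>The power consists of \<open>j = n - 1\<close> convolutions applied to
    \<open>G\<close>. So \<open>j\<close> derivatives produce \<open>T^j G\<close>, which is
    \<open>T^n\<close> of the constant \<open>1\<close>, and one derivative remains.\<close>
  have "(deriv ^^ n) (conv_pow G n) x = deriv ((deriv ^^ j) (((\<lambda>g. conv g G) ^^ j) G)) x"
    by (simp add: j cp del: conv_pow.simps)
  also have "\<dots> = deriv ((T ^^ n) (\<lambda>_. 1)) x"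
    using x by (intro deriv_cong_pos)
      (simp_all add: deriv_conv_G_funpow loc_int_G j funpow_swap1)
  also have "\<dots> = (\<Sum>i\<le>n. real (n choose i) * c ^ (n - i) * ((-1) ^ i * (if i = 0 then 0 else conv_pow v i x)))"
    unfolding T_funpow_expand[OF one]
  proof (intro DERIV_imp_deriv DERIV_sum DERIV_cmult)
    \<comment> \<open>For \<open>i = 0\<close> the function is the constant \<open>1\<close> and its
      derivative vanishes, so the final sum starts at \<open>1\<close>.\<close>
    fix i
    show "((U ^^ i) (\<lambda>_. 1) has_real_derivative (if i = 0 then 0 else conv_pow v i x)) (at x)"
      using x by (cases "i = 0")
        (auto simp: U_funpow_one simp del: funpow.simps intro!: conv_one_has_real_derivative loc_int_conv_pow v)
  qed
  also have "{..n} = insert 0 {1..n}" by auto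
  finally show ?thesis by simp
qed

end

subsection \<open>Damped densities and their tails\<close>

lemma power_le_fact_exp:
  fixes t :: real
  assumes "0 \<le> t"
  shows "exp (- t) * t ^ j \<le> fact j"
proof -
  have "(\<Sum>i\<in>{j}. t ^ i /\<^sub>R fact i) \<le> (\<Sum>i. t ^ i /\<^sub>R fact i)"
    by (rule sum_le_suminf) (use assms exp_converges[of t] in \<open>auto simp: sums_iff\<close>)
  then have "t ^ j / fact j \<le> exp t"
    using exp_converges[of t] by (simp add: sums_iff field_simps)
  then show ?thesis by (simp add: exp_minus field_simps)
qed

text \<open>Describes \<open>u\<close> and its damped versions alike; for
  \<open>\<epsilon> > 0\<close> the latter have finite mass and so fail
  \<open>levy_density\<close>.\<close>

definition small_jump_integrable :: "(real \<Rightarrow> real) \<Rightarrow> bool" where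
  "small_jump_integrable v \<longleftrightarrow> continuous_on {0<..} v \<and> (\<forall>x>0. 0 \<le> v x) \<and>
     set_integrable lborel {0<..} (\<lambda>x. min 1 x * v x)"

lemma set_integrable_bound_min:
  assumes v: "small_jump_integrable v" and w: "continuous_on A w" and A: "A \<in> sets borel" "A \<subseteq> {0<..}"
    and le: "\<And>x. x \<in> A \<Longrightarrow> \<bar>w x\<bar> \<le> C * (min 1 x * v x)"
  shows "set_integrable lborel A w"
proof (rule set_integrable_bound)
  show "set_integrable lborel A (\<lambda>x. C * (min 1 x * v x))"
    using v A by (intro set_integrable_mult_right) (auto simp: small_jump_integrable_def intro: set_integrable_subset)
  show "set_borel_measurable lborel A w"
    using borel_measurable_continuous_on_indicator[OF A(1) w] by (simp add: set_borel_measurable_def)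
  show "AE x in lborel. x \<in> A \<longrightarrow> norm (w x) \<le> norm (C * (min 1 x * v x))"
    using order_trans[OF le abs_ge_self] by (intro AE_I2) auto
qed

lemma small_jump_integrable_tail:
  assumes v: "small_jump_integrable v" and a: "0 < a"
  shows "set_integrable lborel {a<..} v"
proof (rule set_integrable_bound_min[OF v, where C = "1 / min 1 a"])
  show "continuous_on {a<..} v"
    using v a by (auto simp: small_jump_integrable_def intro: continuous_on_subset)
  fix x assume x: "x \<in> {a<..}"
  have "min 1 a * v x \<le> min 1 x * v x"
    using v x a by (intro mult_right_mono) (auto simp: small_jump_integrable_def)
  then show "\<bar>v x\<bar> \<le> 1 / min 1 a * (min 1 x * v x)"
    using v x a by (simp add: small_jump_integrable_def pos_le_divide_eq mult.commute)
qed (use a in auto)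

lemma tail_has_real_derivative:
  assumes v: "small_jump_integrable v" and x: "0 < x"
  shows "(tail v has_real_derivative - v x) (at x)"
proof -
  define a where "a = x / 2"
  have a: "0 < a" "a < x" using x by (auto simp: a_def)
  have "((\<lambda>t. tail v a - (LBINT y:{a<..<t}. v y)) has_real_derivative 0 - v x) (at x)"
    using v by (intro DERIV_diff DERIV_const has_real_derivative_set_integral a)
      (simp add: small_jump_integrable_def)
  then have "((\<lambda>t. tail v a - (LBINT y:{a<..<t}. v y)) has_real_derivative - v x) (at x)" by simp
  then show ?thesis
  proof (rule has_field_derivative_transform_within_open[of _ _ _ "{a<..}"])
    fix t assume t: "t \<in> {a<..}"
    have "tail v a = (LBINT y:{a<..<t} \<union> {t<..}. v y)"
      unfolding tail_def using t
      by (intro set_integral_discrete_difference[of "{t}"]) auto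
    also have "\<dots> = (LBINT y:{a<..<t}. v y) + (LBINT y:{t<..}. v y)"
      by (intro set_integral_Un set_integrable_subset[OF small_jump_integrable_tail[OF v a(1)]])
        (use t in auto)
    finally show "tail v a - (LBINT y:{a<..<t}. v y) = tail v t" by (simp add: tail_def)
  qed (use a in auto)
qed

text \<open>By Fubini the integral of the tail over \<open>(0,X)\<close> is that of
  \<open>min X y * v y\<close>, and \<open>min X y\<close> is at most \<open>max 1 X\<close> times
  \<open>min 1 y\<close>.\<close>

lemma loc_int_tail:
  assumes v: "small_jump_integrable v"
  shows "loc_int (tail v)"
  unfolding loc_int_def set_integrable_def
proof (intro conjI allI impI)
  show "continuous_on {0<..} (tail v)"
    by (rule DERIV_continuous_on) (auto intro: has_field_derivative_at_within tail_has_real_derivative[OF v])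
  fix X :: real assume X: "0 < X"
  have cont: "continuous_on {0<..} v" and nn: "\<And>x. 0 < x \<Longrightarrow> 0 \<le> v x"
    using v by (auto simp: small_jump_integrable_def)
  note [measurable] = borel_measurable_on_pos[OF cont]
  \<comment> \<open>The kernel lives on \<open>0 < t < min X y\<close>; the rewriting
    \<open>K\<close> is suited to integration in \<open>t\<close>, and \<open>K'\<close> to
    integration in \<open>y\<close>.\<close>
  define K where "K = (\<lambda>y t. on_pos v y * (if 0 < t \<and> t < X \<and> t < y then 1 else (0::real)))"
  have K: "K y t = on_pos v y * indicator {0<..<min X y} t" for y t
    by (auto simp: K_def)
  have K': "K y t = indicator {0<..<X} t *\<^sub>R (indicator {t<..} y *\<^sub>R v y)" for y t
    by (auto simp: K_def on_pos_def split: split_indicator)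
  have "set_integrable lborel {0<..} (\<lambda>y. min X y * v y)"
  proof (rule set_integrable_bound_min[OF v, where C = "max 1 X"])
    show "continuous_on {0<..} (\<lambda>y. min X y * v y)" by (intro continuous_intros cont)
    fix x :: real assume x: "x \<in> {0<..}"
    have "min X x \<le> max 1 X * min 1 x" using X x by (auto simp: min_def max_def)
    then have "min X x * v x \<le> max 1 X * min 1 x * v x" using nn x by (intro mult_right_mono) auto
    then show "\<bar>min X x * v x\<bar> \<le> max 1 X * (min 1 x * v x)" using nn[of x] x X by (simp add: abs_mult mult.assoc)
  qed auto
  then have i: "integrable lborel (\<lambda>y. indicator {0<..} y *\<^sub>R (min X y * v y))"
    by (simp add: set_integrable_def)
  have "integrable (lborel \<Otimes>\<^sub>M lborel) (\<lambda>(y,t). K y t)"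
  proof (rule lborel_pair.Fubini_integrable)
    show "(\<lambda>(y,t). K y t) \<in> borel_measurable (lborel \<Otimes>\<^sub>M lborel)"
      unfolding K_def by measurable
    have "(\<integral>t. norm (case (y,t) of (y,t) \<Rightarrow> K y t) \<partial>lborel) = indicator {0<..} y *\<^sub>R (min X y * v y)" for y
      using nn[of y] X by (auto simp: K on_pos_def abs_mult split: split_indicator)
    with i show "integrable lborel (\<lambda>y. \<integral>t. norm (case (y,t) of (y,t) \<Rightarrow> K y t) \<partial>lborel)" by simp
    show "AE y in lborel. integrable lborel (\<lambda>t. case (y,t) of (y,t) \<Rightarrow> K y t)"
      unfolding K case_prod_conv by (intro AE_I2 integrable_mult_right integrable_real_indicator emeasure_bounded_finite) auto
  qed
  then have "integrable lborel (\<lambda>t. \<integral>y. K y t \<partial>lborel)"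
    using lborel_pair.integrable_fst[of "\<lambda>t y. K y t"] lborel_pair.integrable_product_swap_iff[of "\<lambda>(y,t). K y t"]
    by (simp add: case_prod_unfold)
  then show "integrable lborel (\<lambda>t. indicator {0<..<X} t *\<^sub>R tail v t)"
    by (simp add: K' tail_def set_lebesgue_integral_def)
qed

section \<open>Damped densities\<close>

lemma damped_0: "damped u 0 = u"
  by (simp add: damped_def fun_eq_iff)

lemma damped_le:
  assumes "small_jump_integrable u" "0 \<le> \<epsilon>" "0 < x"
  shows "0 \<le> damped u \<epsilon> x" "damped u \<epsilon> x \<le> u x"
  using assms by (auto simp: damped_def small_jump_integrable_def mult_left_le_one_le)

lemma continuous_on_damped: "continuous_on {0<..} u \<Longrightarrow> continuous_on {0<..} (damped u \<epsilon>)"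
  unfolding damped_def[abs_def] by (intro continuous_intros) auto

lemma small_jump_integrable_damped:
  assumes u: "small_jump_integrable u" and e: "0 \<le> \<epsilon>"
  shows "small_jump_integrable (damped u \<epsilon>)"
proof -
  have c: "continuous_on {0<..} (damped u \<epsilon>)"
    using u by (intro continuous_on_damped) (simp add: small_jump_integrable_def)
  have "set_integrable lborel {0<..} (\<lambda>x. min 1 x * damped u \<epsilon> x)"
  proof (rule set_integrable_bound_min[OF u, where C = 1])
    show "continuous_on {0<..} (\<lambda>x. min 1 x * damped u \<epsilon> x)" by (intro continuous_intros c)
    fix x :: real assume "x \<in> {0<..}"
    then show "\<bar>min 1 x * damped u \<epsilon> x\<bar> \<le> 1 * (min 1 x * u x)"
      using damped_le[OF u e, of x] by (simp add: abs_mult mult_left_mono)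
  qed auto
  with c damped_le[OF u e] show ?thesis by (simp add: small_jump_integrable_def)
qed

text \<open>The damping supplies the missing factor at \<open>0\<close>:
  \<open>exp (- t) * t \<le> 1\<close> with \<open>t = \<epsilon> / x\<close> gives
  \<open>exp (- \<epsilon> / x) \<le> x / \<epsilon>\<close>. Beyond \<open>1\<close> the trivial
  bound \<open>1\<close> suffices.\<close>

lemma damped_set_integrable:
  assumes u: "small_jump_integrable u" and e: "0 < \<epsilon>"
  shows "set_integrable lborel {0<..} (damped u \<epsilon>)"
proof (rule set_integrable_bound_min[OF u, where C = "max 1 (1 / \<epsilon>)"])
  show "continuous_on {0<..} (damped u \<epsilon>)"
    using u by (intro continuous_on_damped) (simp add: small_jump_integrable_def)
  fix x :: real assume "x \<in> {0<..}"
  then have x: "0 < x" by simp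
  have "exp (- \<epsilon> / x) \<le> x / \<epsilon>"
    using power_le_fact_exp[of "\<epsilon> / x" 1] x e by (simp add: field_simps)
  moreover have "exp (- \<epsilon> / x) \<le> 1" using x e by simp
  moreover have "x / \<epsilon> \<le> max 1 (1 / \<epsilon>) * x"
    using mult_right_mono[of "1 / \<epsilon>" "max 1 (1 / \<epsilon>)" x] x by simp
  ultimately have "exp (- \<epsilon> / x) \<le> max 1 (1 / \<epsilon>) * min 1 x"
    by (cases "x \<le> 1") (auto simp: min_def intro: order_trans[OF _ max.cobounded1])
  then have "exp (- \<epsilon> / x) * u x \<le> max 1 (1 / \<epsilon>) * min 1 x * u x"
    using u x by (intro mult_right_mono) (auto simp: small_jump_integrable_def)
  then show "\<bar>damped u \<epsilon> x\<bar> \<le> max 1 (1 / \<epsilon>) * (min 1 x * u x)"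
    using damped_le[OF u, of \<epsilon> x] x e by (simp add: damped_def mult.assoc)
qed auto

lemma loc_int_set_integrable:
  assumes "continuous_on {0<..} v" "set_integrable lborel {0<..} v"
  shows "loc_int v"
  using assms by (auto simp: loc_int_def intro: set_integrable_subset)

text \<open>The mass above \<open>x\<close> is the total mass minus the mass below \<open>x\<close>.
  This places the tail of a finite density in the operator calculus, as the image of the constant
  \<open>1\<close>.\<close>

lemma tail_eq_point_mass_minus:
  assumes v: "set_integrable lborel {0<..} v" and x: "0 < x"
  shows "tail v x = point_mass_minus (LBINT x:{0<..}. v x) v (\<lambda>_. 1) x"
proof -
  have "(LBINT y:{0<..}. v y) = (LBINT y:{0<..<x} \<union> {x<..}. v y)"
    using x by (intro set_integral_discrete_difference[of "{x}"]) auto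
  also have "\<dots> = (LBINT y:{0<..<x}. v y) + (LBINT y:{x<..}. v y)"
    by (intro set_integral_Un set_integrable_subset[OF v]) (use x in auto)
  finally show ?thesis
    by (simp add: point_mass_minus_def conv_commute[of "\<lambda>_. 1"] conv_one tail_def)
qed

text \<open>Damping only decreases \<open>u\<close>, so \<open>tail u\<close> is a majorant of the
  family, and \<open>u\<close> beyond \<open>x\<close> is a majorant of the integrands.\<close>

lemma dom_family_tail:
  assumes u: "small_jump_integrable u"
  shows "dom_family (\<lambda>\<epsilon>. tail (damped u \<epsilon>))"
proof (rule dom_familyI)
  note sd = small_jump_integrable_damped[OF u]
  show "continuous_on {0<..} (tail (damped u \<epsilon>))" if "0 \<le> \<epsilon>" for \<epsilon>
    using loc_int_tail[OF sd[OF that]] by (simp add: loc_int_def)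
  show "loc_int (tail u)" by (rule loc_int_tail[OF u])
  fix x :: real assume x: "0 < x"
  show "\<bar>tail (damped u \<epsilon>) x\<bar> \<le> tail u x" if e: "0 \<le> \<epsilon>" for \<epsilon>
  proof -
    have "tail (damped u \<epsilon>) x \<le> tail u x"
      unfolding tail_def
      by (intro set_integral_mono small_jump_integrable_tail sd u x e)
        (use damped_le[OF u e] x in auto)
    moreover have "0 \<le> tail (damped u \<epsilon>) x"
      unfolding tail_def set_lebesgue_integral_def
      using damped_le[OF u e] x by (intro Bochner_Integration.integral_nonneg) (auto split: split_indicator)
    ultimately show ?thesis by simp
  qed
  have m: "(\<lambda>y. indicator {x<..} y *\<^sub>R damped u \<epsilon> y) \<in> borel_measurable lborel" if "0 \<le> \<epsilon>" for \<epsilon>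
    using small_jump_integrable_tail[OF sd[OF that] x] by (auto simp: set_integrable_def)
  show "((\<lambda>\<epsilon>. tail (damped u \<epsilon>) x) \<longlongrightarrow> tail (damped u 0) x) (at_right 0)"
    unfolding tail_def set_lebesgue_integral_def
  proof (rule dominated_convergence_at_right_0)
    show "integrable lborel (\<lambda>y. indicator {x<..} y *\<^sub>R u y)"
      using small_jump_integrable_tail[OF u x] by (simp add: set_integrable_def)
    show "AE y in lborel. \<bar>indicator {x<..} y *\<^sub>R damped u \<epsilon> y\<bar> \<le> indicator {x<..} y *\<^sub>R u y" if "0 < \<epsilon>" for \<epsilon>
      using damped_le[OF u, of \<epsilon>] x that by (intro AE_I2) (auto split: split_indicator)
    show "AE y in lborel. ((\<lambda>\<epsilon>. indicator {x<..} y *\<^sub>R damped u \<epsilon> y) \<longlongrightarrow> indicator {x<..} y *\<^sub>R damped u 0 y) (at_right 0)"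
    proof (rule AE_I2)
      fix y
      show "((\<lambda>\<epsilon>. indicator {x<..} y *\<^sub>R damped u \<epsilon> y) \<longlongrightarrow> indicator {x<..} y *\<^sub>R damped u 0 y) (at_right 0)"
        using x unfolding damped_def by (cases "x < y") (auto intro!: tendsto_eq_intros)
    qed
  qed (use m in auto)
qed

text \<open>
  Up to linear combinations these functions are closed under the Euler operator, and the factor
  \<open>exp (-\<epsilon>/x) (\<epsilon>/x)\<^sup>j\<close> is bounded by \<open>j!\<close>.
\<close>

definition damped_term :: "(real \<Rightarrow> real) \<Rightarrow> nat \<Rightarrow> nat \<Rightarrow> real \<Rightarrow> real \<Rightarrow> real" where
  "damped_term u k j = (\<lambda>\<epsilon> x. exp (- \<epsilon> / x) * (\<epsilon> / x) ^ j * (x ^ (k + 1) * (deriv ^^ k) u x))"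

lemma dom_family_damped_term:
  assumes g: "loc_int (\<lambda>x. x ^ (k + 1) * (deriv ^^ k) u x)"
  shows "dom_family (damped_term u k j)"
proof (rule dom_familyI)
  let ?g = "\<lambda>x. x ^ (k + 1) * (deriv ^^ k) u x"
  show "continuous_on {0<..} (damped_term u k j \<epsilon>)" for \<epsilon>
  proof -
    have "continuous_on {0<..} ?g" using g by (simp add: loc_int_def)
    then show ?thesis unfolding damped_term_def
      by (intro continuous_on_mult[OF _ \<open>continuous_on {0<..} ?g\<close>] continuous_intros) auto
  qed
  show "loc_int (\<lambda>x. fact j * \<bar>?g x\<bar>)" by (intro loc_int_cmult loc_int_abs g)
  fix x :: real assume x: "0 < x"
  show "\<bar>damped_term u k j \<epsilon> x\<bar> \<le> fact j * \<bar>?g x\<bar>" if "0 \<le> \<epsilon>" for \<epsilon>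
  proof -
    have "\<bar>exp (- \<epsilon> / x) * (\<epsilon> / x) ^ j\<bar> \<le> fact j"
      using power_le_fact_exp[of "\<epsilon> / x" j] that x by simp
    then show ?thesis unfolding damped_term_def abs_mult[of _ "?g x"]
      by (intro mult_right_mono) auto
  qed
  show "((\<lambda>\<epsilon>. damped_term u k j \<epsilon> x) \<longlongrightarrow> damped_term u k j 0 x) (at_right 0)"
    unfolding damped_term_def using x by (intro tendsto_intros) auto
qed

text \<open>Product rule: differentiating the exponential raises \<open>j\<close>, the power of
  \<open>\<epsilon> / x\<close> contributes \<open>- j\<close>, the power \<open>x ^ (k + 2)\<close>
  contributes \<open>k + 2\<close>, and the derivative of \<open>u\<close> raises
  \<open>k\<close>.\<close>

lemma damped_term_has_real_derivative:
  assumes D: "((deriv ^^ k) u has_real_derivative (deriv ^^ Suc k) u x) (at x)" and x: "0 < x"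
  shows "((\<lambda>x. x * damped_term u k j \<epsilon> x) has_real_derivative
    damped_term u k (Suc j) \<epsilon> x + (real k + 2 - real j) * damped_term u k j \<epsilon> x + damped_term u (Suc k) j \<epsilon> x) (at x)"
proof -
  have 0: "((\<lambda>x. \<epsilon> / x) has_real_derivative (- \<epsilon> / x\<^sup>2)) (at x)"
    using x by (auto intro!: derivative_eq_intros simp: power2_eq_square)
  have 1: "((\<lambda>x. exp (- (\<epsilon> / x))) has_real_derivative exp (- (\<epsilon> / x)) * (\<epsilon> / x\<^sup>2)) (at x)"
    using DERIV_fun_exp[OF DERIV_minus[OF 0]] by simp
  have 2: "((\<lambda>x. (\<epsilon> / x) ^ j) has_real_derivative (- real j * (\<epsilon> / x) ^ j / x)) (at x)"
  proof -
    have "real j * (- \<epsilon> / x\<^sup>2 * (\<epsilon> / x) ^ (j - Suc 0)) = - real j * (\<epsilon> / x) ^ j / x"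
      using x by (cases j) (auto simp: field_simps power2_eq_square)
    with DERIV_power[OF 0, of j] show ?thesis by simp
  qed
  have 3: "((\<lambda>x. x ^ (k + 2)) has_real_derivative (real k + 2) * x ^ (k + 1)) (at x)"
    using DERIV_pow[of "k + 2" x] by (simp add: add.commute)
  define E P Q A B where "E = exp (- (\<epsilon> / x))" "P = (\<epsilon> / x) ^ j" "Q = x ^ (k + 1)"
    "A = (deriv ^^ k) u x" "B = (deriv ^^ Suc k) u x"
  note defs = this
  have "((\<lambda>x. exp (- (\<epsilon> / x)) * (\<epsilon> / x) ^ j * (x ^ (k + 2) * (deriv ^^ k) u x)) has_real_derivative
     (E * (\<epsilon> / x\<^sup>2) * P + (- real j * P / x) * E) * (x ^ (k + 2) * A)
      + ((real k + 2) * Q * A + B * x ^ (k + 2)) * (E * P)) (at x)"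
    unfolding defs by (intro DERIV_mult 1 2 3 D)
  moreover have "(\<lambda>x. exp (- (\<epsilon> / x)) * (\<epsilon> / x) ^ j * (x ^ (k + 2) * (deriv ^^ k) u x)) =
      (\<lambda>x. x * damped_term u k j \<epsilon> x)"
    by (auto simp: damped_term_def fun_eq_iff)
  moreover have "(E * (\<epsilon> / x\<^sup>2) * P + (- real j * P / x) * E) * (x ^ (k + 2) * A)
      + ((real k + 2) * Q * A + B * x ^ (k + 2)) * (E * P) =
      E * ((\<epsilon> / x) * P) * (Q * A) + (real k + 2 - real j) * (E * P * (Q * A)) + E * P * (x * Q * B)"
  proof -
    have "x ^ (k + 2) = x * Q" by (simp add: defs)
    then show ?thesis using x by (simp add: field_simps power2_eq_square)
  qed
  ultimately show ?thesis by (simp add: damped_term_def defs)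
qed

text \<open>An Euler step raises \<open>k\<close> by at most one, so \<open>N\<close> steps use
  derivatives of \<open>u\<close> up to order \<open>k + N\<close>; the index \<open>j\<close> may
  grow freely.\<close>

lemma euler_family_damped_term:
  assumes D: "\<And>k x. k < m \<Longrightarrow> 0 < x \<Longrightarrow> ((deriv ^^ k) u has_real_derivative (deriv ^^ Suc k) u x) (at x)"
    and g: "\<And>k. k \<le> m \<Longrightarrow> loc_int (\<lambda>x. x ^ (k + 1) * (deriv ^^ k) u x)"
  shows "k + N \<le> m \<Longrightarrow> euler_family N (damped_term u k j)"
proof (induction N arbitrary: k j)
  case 0
  then show ?case by (auto intro: dom_family_damped_term g)
next
  case (Suc N)
  let ?f1 = "\<lambda>\<epsilon> x. damped_term u k (Suc j) \<epsilon> x + (real k + 2 - real j) * damped_term u k j \<epsilon> x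
     + damped_term u (Suc k) j \<epsilon> x"
  have d: "dom_family (damped_term u k j)" using Suc.prems by (intro dom_family_damped_term g) simp
  have f1: "euler_family N ?f1"
    using Suc.prems by (intro euler_family_add euler_family_cmult Suc.IH) auto
  have "euler (damped_term u k j \<epsilon>) (?f1 \<epsilon>)" if "0 \<le> \<epsilon>" for \<epsilon>
    using Suc.prems that
    by (intro euler_intro dom_family_loc_int[OF d] dom_family_loc_int[OF euler_family_dom[OF f1]]
        damped_term_has_real_derivative D) auto
  with d f1 show ?case by (auto intro!: exI[of _ ?f1])
qed

text \<open>The Euler operator sends the tail to itself minus \<open>damped_term u 0 0\<close>.
  Being an antiderivative, the tail gains one level over the density, hence the bound
  \<open>Suc m\<close>.\<close>

lemma euler_family_tail:
  assumes u: "small_jump_integrable u"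
    and D: "\<And>k x. k < m \<Longrightarrow> 0 < x \<Longrightarrow> ((deriv ^^ k) u has_real_derivative (deriv ^^ Suc k) u x) (at x)"
    and g: "\<And>k. k \<le> m \<Longrightarrow> loc_int (\<lambda>x. x ^ (k + 1) * (deriv ^^ k) u x)"
  shows "N \<le> Suc m \<Longrightarrow> euler_family N (\<lambda>\<epsilon>. tail (damped u \<epsilon>))"
proof (induction N)
  case 0
  then show ?case by (simp add: dom_family_tail u)
next
  case (Suc N)
  let ?f1 = "\<lambda>\<epsilon> x. tail (damped u \<epsilon>) x + (-1) * damped_term u 0 0 \<epsilon> x"
  have f1: "euler_family N ?f1"
    using Suc.prems
    by (intro euler_family_add euler_family_cmult Suc.IH euler_family_damped_term[where m = m] D g) auto
  have "euler (tail (damped u \<epsilon>)) (?f1 \<epsilon>)" if e: "0 \<le> \<epsilon>" for \<epsilon>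
  proof (rule euler_intro)
    show "loc_int (tail (damped u \<epsilon>))" by (intro loc_int_tail small_jump_integrable_damped u e)
    show "loc_int (?f1 \<epsilon>)" by (rule dom_family_loc_int[OF euler_family_dom[OF f1] e])
    fix x :: real assume x: "0 < x"
    have "((\<lambda>x. x * tail (damped u \<epsilon>) x) has_real_derivative
        1 * tail (damped u \<epsilon>) x + - damped u \<epsilon> x * x) (at x)"
      by (intro DERIV_mult DERIV_ident tail_has_real_derivative small_jump_integrable_damped u e x)
    then show "((\<lambda>x. x * tail (damped u \<epsilon>) x) has_real_derivative ?f1 \<epsilon> x) (at x)"
      by (simp add: damped_term_def damped_def algebra_simps)
  qed
  with f1 show ?case by (auto intro!: exI[of _ ?f1] dom_family_tail u)
qed

text \<open>No limit is involved for positive \<open>\<epsilon>\<close>: the tail agrees with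
  \<open>?G\<close> at positive arguments, and there convolution powers and derivatives see nothing
  else.\<close>

lemma u_approx_eq_deriv:
  assumes u: "small_jump_integrable u" and e: "0 < \<epsilon>" and n: "1 \<le> n" and x: "0 < x"
  shows "u_approx u n \<epsilon> x = (-1) ^ n * (deriv ^^ n) (conv_pow (tail (damped u \<epsilon>)) n) x"
proof -
  let ?v = "damped u \<epsilon>"
  let ?G = "point_mass_minus (damped_mass u \<epsilon>) ?v (\<lambda>_. 1)"
  have v: "set_integrable lborel {0<..} ?v" by (rule damped_set_integrable[OF u e])
  have lv: "loc_int ?v"
    using u by (intro loc_int_set_integrable v continuous_on_damped) (simp add: small_jump_integrable_def)
  have "(deriv ^^ n) (conv_pow (tail ?v) n) x = (deriv ^^ n) (conv_pow ?G n) x"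
    using n x by (intro deriv_funpow_cong_pos conv_pow_cong)
      (auto simp: tail_eq_point_mass_minus[OF v] damped_mass_def)
  also have "\<dots> = (\<Sum>i=1..n. real (n choose i) * damped_mass u \<epsilon> ^ (n - i) * ((-1) ^ i * conv_pow ?v i x))"
    by (rule deriv_conv_pow_point_mass_minus_one[OF lv n x])
  also have "(-1) ^ n * \<dots> = u_approx u n \<epsilon> x"
    unfolding u_approx_def sum_distrib_left
  proof (rule sum.cong)
    fix i assume i: "i \<in> {1..n}"
    \<comment> \<open>With this the two factors \<open>(-1) ^ i\<close> cancel and the sign
      \<open>(-1) ^ (n - i)\<close> is left.\<close>
    then have "(-1::real) ^ n = (-1) ^ (n - i) * (-1) ^ i" by (simp flip: power_add)
    then show "(- 1) ^ n * (real (n choose i) * damped_mass u \<epsilon> ^ (n - i) * ((- 1) ^ i * conv_pow ?v i x)) =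
      (- 1) ^ (n - i) * real (n choose i) * conv_pow ?v i x * damped_mass u \<epsilon> ^ (n - i)"
      by simp
  qed simp
  finally show ?thesis ..
qed

section \<open>Integrability drawn from the hypotheses on \<open>u\<close>\<close>

lemma levy_density_small_jump_integrable:
  assumes u: "levy_density u" and c: "continuous_on {0<..} u"
  shows "small_jump_integrable u"
proof -
  have nn: "\<And>x. 0 < x \<Longrightarrow> 0 \<le> u x" using u by (simp add: levy_density_def)
  have "continuous_on {0<..} (\<lambda>x. min 1 x * u x)" by (intro continuous_intros c)
  from borel_measurable_continuous_on_indicator[OF _ this]
  have m: "(\<lambda>x. indicator {0<..} x *\<^sub>R (min 1 x * u x)) \<in> borel_measurable lborel"
    by simp
  have "(\<integral>\<^sup>+x. ennreal (norm (indicator {0<..} x *\<^sub>R (min 1 x * u x))) \<partial>lborel) =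
      (\<integral>\<^sup>+x\<in>{0<..}. ennreal (min 1 x * u x) \<partial>lborel)"
    by (intro nn_integral_cong) (auto simp: nn abs_mult split: split_indicator)
  also have "\<dots> < \<infinity>" using u by (simp add: levy_density_def)
  finally have "set_integrable lborel {0<..} (\<lambda>x. min 1 x * u x)"
    unfolding set_integrable_def by (rule integrableI_bounded[OF m])
  with nn c show ?thesis by (simp add: small_jump_integrable_def)
qed

lemma loc_int_weighted:
  assumes c: "continuous_on {0<..} h" and r: "0 < r"
    and i: "set_integrable lborel {0<..} (\<lambda>x. exp (- r * x) * x ^ j * \<bar>h x\<bar>)"
  shows "loc_int (\<lambda>x. x ^ j * h x)"
  unfolding loc_int_def
proof (intro conjI allI impI)
  show ch: "continuous_on {0<..} (\<lambda>x. x ^ j * h x)" by (intro continuous_intros c)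
  fix X :: real assume X: "0 < X"
  show "set_integrable lborel {0<..<X} (\<lambda>x. x ^ j * h x)"
  proof (rule set_integrable_bound)
    show "set_integrable lborel {0<..<X} (\<lambda>x. exp (r * X) * (exp (- r * x) * x ^ j * \<bar>h x\<bar>))"
      by (intro set_integrable_mult_right set_integrable_subset[OF i]) auto
    have "continuous_on {0<..<X} (\<lambda>x. x ^ j * h x)" by (rule continuous_on_subset[OF ch]) auto
    from borel_measurable_continuous_on_indicator[OF _ this]
    show "set_borel_measurable lborel {0<..<X} (\<lambda>x. x ^ j * h x)"
      by (simp add: set_borel_measurable_def)
    show "AE x in lborel. x \<in> {0<..<X} \<longrightarrow> norm (x ^ j * h x) \<le> norm (exp (r * X) * (exp (- r * x) * x ^ j * \<bar>h x\<bar>))"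
    proof (intro AE_I2 impI)
      fix x assume x: "x \<in> {0<..<X}"
      have "1 * (x ^ j * \<bar>h x\<bar>) \<le> exp (r * X - r * x) * (x ^ j * \<bar>h x\<bar>)"
        using x r by (intro mult_right_mono) auto
      then show "norm (x ^ j * h x) \<le> norm (exp (r * X) * (exp (- r * x) * x ^ j * \<bar>h x\<bar>))"
        using x by (simp add: abs_mult exp_diff exp_minus field_simps)
    qed
  qed
qed

theorem theorem3:
  fixes u :: "real \<Rightarrow> real" and n m :: nat and r :: real
  assumes "levy_density u"
    and "n \<ge> 1" and "m \<ge> n + 2" and "r > 0"
    and "cont_diff_pos m u"
    and "\<And>k. k \<le> m \<Longrightarrow>
           set_integrable lborel {0<..} (\<lambda>x. exp (- r * x) * x ^ (k + 1) * \<bar>(deriv ^^ k) u x\<bar>)"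
  shows "((\<forall>x>0. set_integrable lborel {x<..} u \<and> conv_pow_defined (tail u) n x) \<and>
          cont_diff_pos n (conv_pow (tail u) n)) \<and>
         ((\<forall>\<epsilon>>0. set_integrable lborel {0<..} (damped u \<epsilon>) \<and>
                 (\<forall>k\<in>{1..n}. \<forall>x>0. conv_pow_defined (damped u \<epsilon>) k x)) \<and>
          (\<forall>x>0. ((\<lambda>\<epsilon>. u_approx u n \<epsilon> x) \<longlongrightarrow> u_limit u n x) (at_right 0)))"
proof -
  have D: "((deriv ^^ k) u has_real_derivative (deriv ^^ Suc k) u x) (at x)" if "k < m" "0 < x" for k x
    using assms(5) that by (auto simp: cont_diff_pos_def DERIV_deriv_iff_real_differentiable)
  have c: "continuous_on {0<..} ((deriv ^^ k) u)" if "k \<le> m" for k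
  proof (cases "k = m")
    case True then show ?thesis using assms(5) by (simp add: cont_diff_pos_def)
  next
    case False
    with that show ?thesis
      by (intro DERIV_continuous_on[of _ _ "(deriv ^^ Suc k) u"] has_field_derivative_at_within[OF D]) auto
  qed
  have u: "small_jump_integrable u"
    using levy_density_small_jump_integrable[OF assms(1)] c[of 0] by simp
  have g: "loc_int (\<lambda>x. x ^ (k + 1) * (deriv ^^ k) u x)" if "k \<le> m" for k
    by (rule loc_int_weighted[OF c[OF that] assms(4) assms(6)[OF that]])
  \<comment> \<open>Only the tail has to be analysed: its \<open>n\<close> Euler levels pass to the
    convolution power and become \<open>n\<close> ordinary derivatives.\<close>
  have "euler_family n (\<lambda>\<epsilon>. tail (damped u \<epsilon>))"
    by (rule euler_family_tail[OF u D g]) (use assms(3) in auto)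
  then have S: "smooth_family n (\<lambda>\<epsilon>. conv_pow (tail (damped u \<epsilon>)) n)"
    by (intro euler_family_imp_smooth euler_family_conv_pow assms(2))
  \<comment> \<open>The member of the family at \<open>\<epsilon> = 0\<close> is the convolution
    power of \<open>tail u\<close> itself.\<close>
  have "cont_diff_pos n (conv_pow (tail u) n)"
    using smooth_family_cont_diff_pos[OF S, of 0] by (simp add: damped_0)
  moreover have "((\<lambda>\<epsilon>. u_approx u n \<epsilon> x) \<longlongrightarrow> u_limit u n x) (at_right 0)" if x: "0 < x" for x
  proof -
    have "((\<lambda>\<epsilon>. (-1) ^ n * (deriv ^^ n) (conv_pow (tail (damped u \<epsilon>)) n) x) \<longlongrightarrow> u_limit u n x) (at_right 0)"
      using smooth_family_deriv_tendsto[OF S x] unfolding u_limit_def damped_0 by (rule tendsto_mult_left)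
    \<comment> \<open>The identity is available for \<open>\<epsilon> > 0\<close>, where the damped
      mass is finite, and the right-hand limit looks at no other values.\<close>
    moreover have "eventually (\<lambda>\<epsilon>. (-1) ^ n * (deriv ^^ n) (conv_pow (tail (damped u \<epsilon>)) n) x = u_approx u n \<epsilon> x) (at_right 0)"
      using eventually_at_right_less[of 0] by eventually_elim (simp add: u_approx_eq_deriv[OF u _ assms(2) x])
    ultimately show ?thesis by (rule Lim_transform_eventually)
  qed
  moreover have "loc_int (damped u \<epsilon>)" if "0 < \<epsilon>" for \<epsilon>
    using c[of 0] by (intro loc_int_set_integrable continuous_on_damped damped_set_integrable u that) simp
  ultimately show ?thesis
    using small_jump_integrable_tail[OF u] loc_int_tail[OF u] damped_set_integrable[OF u] assms(2)
    by (auto intro: conv_pow_defined)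
qed

end
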